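(* Let $G$ be a finite simple graph on the vertex set $\{x_1,\dots,x_n\}$, let $k$ be a field and $R=k[x_1,\dots,x_n]$. Then $$\operatorname{reg}(R/\mathcal{I}(G))\le \alpha'(G),$$ where $\alpha'(G)$ is the matching number of $G$.
   Context: $\mathcal{I}(G)=(x_ax_b : \{x_a,x_b\}\text{ an edge of }G)\subseteq R$ is the edge ideal of $G$. A matching of $G$ is a set of pairwise disjoint edges, and the matching number $\alpha'(G)$ is the largest size of a matching in $G$. $\operatorname{reg}(M)=\max\{j-i:\beta_{i,j}(M)\neq0\}$ is Castelnuovo–Mumford regularity, $\beta_{i,j}$ being graded Betti numbers over $R$. *)

theory Defs
  imports
    "HOL-Library.Poly_Mapping"
    "HOL-Algebra.Algebraic_Closure_Type"
    "HOL-Algebra.QuotRing"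
    "HOL-Algebra.Module"
begin

subsection \<open>Graphs and matchings\<close>

text \<open>
  The vertex set is the whole finite type \<open>'v\<close>, so \<open>n\<close> is \<open>CARD('v)\<close>; a graph is given by
  its set of edges, each edge being a two-element set of vertices.
\<close>

definition simple_graph :: "'v set set \<Rightarrow> bool" where
  "simple_graph E \<longleftrightarrow> (\<forall>e\<in>E. card e = 2)"

definition is_matching :: "'v set set \<Rightarrow> 'v set set \<Rightarrow> bool" where
  "is_matching E M \<longleftrightarrow> M \<subseteq> E \<and> pairwise disjnt M"

definition matching_number :: "'v::finite set set \<Rightarrow> nat" where
  "matching_number E = Max {card M | M. is_matching E M}"


subsection \<open>The polynomial ring and edge ideals\<close>

text \<open>
  Polynomials over \<open>'k\<close> in the variables indexed by \<open>'v\<close>: finitely supported functions from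
  exponent vectors to coefficients.
\<close>

type_synonym ('v, 'k) mpoly = "('v \<Rightarrow>\<^sub>0 nat) \<Rightarrow>\<^sub>0 'k"

abbreviation poly_ring :: "('v, 'k::field) mpoly ring" where
  "poly_ring \<equiv> ring_of_type_algebra"

definition pvar :: "'v \<Rightarrow> ('v, 'k::field) mpoly" where
  "pvar v = Poly_Mapping.single (Poly_Mapping.single v 1) 1"

definition monom_degree :: "('v::finite \<Rightarrow>\<^sub>0 nat) \<Rightarrow> nat" where
  "monom_degree m = (\<Sum>v\<in>UNIV. Poly_Mapping.lookup m v)"

text \<open>
  The graded component of degree \<open>d\<close> of the polynomial ring (standard grading). It contains 0,
  and it is zero for \<open>d < 0\<close>.
\<close>

definition homog_component :: "int \<Rightarrow> ('v::finite, 'k::field) mpoly set" where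
  "homog_component d = {p. \<forall>m\<in>Poly_Mapping.keys p. int (monom_degree m) = d}"

definition edge_ideal :: "'v set set \<Rightarrow> ('v, 'k::field) mpoly set" where
  "edge_ideal E = Idl\<^bsub>poly_ring\<^esub> {pvar a * pvar b | a b. {a, b} \<in> E}"

text \<open>
  For an ideal \<open>I\<close> of \<open>R\<close>: the quotient \<open>R/I\<close> as an \<open>R\<close>-module (its elements are the cosets of
  \<open>I\<close>), and its grading, which is the one induced from \<open>R\<close> when \<open>I\<close> is homogeneous.
\<close>

definition quotient_module ::
    "('v, 'k::field) mpoly set \<Rightarrow> (('v, 'k) mpoly, ('v, 'k) mpoly set) module" where
  "quotient_module I =
     (let Q = poly_ring Quot I in
      \<lparr>carrier = carrier Q, monoid.mult = monoid.mult Q, one = one Q, ring.zero = ring.zero Q,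
       add = add Q, module.smult = (\<lambda>p C. (I +>\<^bsub>poly_ring\<^esub> p) \<otimes>\<^bsub>Q\<^esub> C)\<rparr>)"

definition quotient_grading ::
    "('v::finite, 'k::field) mpoly set \<Rightarrow> int \<Rightarrow> ('v, 'k) mpoly set set" where
  "quotient_grading I d = (\<lambda>p. I +>\<^bsub>poly_ring\<^esub> p) ` homog_component d"


subsection \<open>Minimal graded free resolutions\<close>

text \<open>
  Data of a complex of finitely generated graded free modules augmented to a module with elements
  in \<open>'m\<close>. The module in homological degree \<open>i\<close>, written \<open>F\<^sub>i\<close> below, is
  \<open>\<Oplus>\<^bsub>b \<in> gens F i\<^esub> R(- gdeg F i b)\<close>: it has one basis element of degree
  \<open>gdeg F i b\<close> for each \<open>b\<close> in \<open>gens F i\<close>. The entry \<open>dif F i a b\<close> is the coefficient at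
  basis element \<open>a\<close> of \<open>F\<^sub>i\<close> of the image of basis element \<open>b\<close> of the module in homological degree
  \<open>i + 1\<close>, and \<open>aug F b\<close> is the image in the resolved module of basis element \<open>b\<close> of \<open>F\<^sub>0\<close>.
  Values at indices outside \<open>gens\<close> carry no meaning.
\<close>

record (overloaded) ('v, 'k::zero, 'm) free_complex =
  gens :: "nat \<Rightarrow> nat set"
  gdeg :: "nat \<Rightarrow> nat \<Rightarrow> int"
  dif :: "nat \<Rightarrow> nat \<Rightarrow> nat \<Rightarrow> ('v \<Rightarrow>\<^sub>0 nat) \<Rightarrow>\<^sub>0 'k"
  aug :: "nat \<Rightarrow> 'm"

definition free_part :: "('v, 'k::field, 'm) free_complex \<Rightarrow> nat \<Rightarrow> (nat \<Rightarrow> ('v, 'k) mpoly) set" where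
  "free_part F i = {u. \<forall>b. b \<notin> gens F i \<longrightarrow> u b = 0}"

definition dif_map ::
    "('v, 'k::field, 'm) free_complex \<Rightarrow> nat \<Rightarrow> (nat \<Rightarrow> ('v, 'k) mpoly) \<Rightarrow> nat \<Rightarrow> ('v, 'k) mpoly" where
  "dif_map F i u = (\<lambda>a. if a \<in> gens F i then \<Sum>b\<in>gens F (Suc i). dif F i a b * u b else 0)"

definition aug_map ::
    "(('v, 'k::field) mpoly, 'm) module \<Rightarrow> ('v, 'k, 'm) free_complex \<Rightarrow> (nat \<Rightarrow> ('v, 'k) mpoly) \<Rightarrow> 'm" where
  "aug_map M F u = finsum M (\<lambda>b. u b \<odot>\<^bsub>M\<^esub> aug F b) (gens F 0)"

text \<open>
  Below, \<open>M\<close> is an \<open>R\<close>-module and \<open>gr d\<close> is its component of degree \<open>d\<close>. The second and third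
  conditions say that the differentials and the augmentation are homogeneous of degree 0.
\<close>

definition graded_free_resolution ::
    "(('v::finite, 'k::field) mpoly, 'm) module \<Rightarrow> (int \<Rightarrow> 'm set) \<Rightarrow> ('v, 'k, 'm) free_complex \<Rightarrow> bool" where
  "graded_free_resolution M gr F \<longleftrightarrow>
     (\<forall>i. finite (gens F i)) \<and>
     (\<forall>i. \<forall>a\<in>gens F i. \<forall>b\<in>gens F (Suc i).
        dif F i a b \<in> homog_component (gdeg F (Suc i) b - gdeg F i a)) \<and>
     (\<forall>b\<in>gens F 0. aug F b \<in> gr (gdeg F 0 b)) \<and>
     aug_map M F ` free_part F 0 = carrier M \<and>
     {u \<in> free_part F 0. aug_map M F u = \<zero>\<^bsub>M\<^esub>} = dif_map F 0 ` free_part F 1 \<and>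
     (\<forall>i. {u \<in> free_part F (Suc i). dif_map F i u = (\<lambda>_. 0)}
            = dif_map F (Suc i) ` free_part F (Suc (Suc i)))"

text \<open>
  Minimality: the image of each differential lies in \<open>\<mm> F\<^sub>i\<close>, where \<open>\<mm>\<close> is the ideal of
  polynomials with zero constant coefficient.
\<close>

definition minimal_graded_free_resolution ::
    "(('v::finite, 'k::field) mpoly, 'm) module \<Rightarrow> (int \<Rightarrow> 'm set) \<Rightarrow> ('v, 'k, 'm) free_complex \<Rightarrow> bool" where
  "minimal_graded_free_resolution M gr F \<longleftrightarrow>
     graded_free_resolution M gr F \<and>
     (\<forall>i. \<forall>u\<in>free_part F (Suc i). \<forall>a. Poly_Mapping.lookup (dif_map F i u a) 0 = 0)"

text \<open>
  The graded Betti number \<open>\<beta>\<^sub>i\<^sub>,\<^sub>j(M)\<close> is the number of copies of \<open>R(-j)\<close> in homological degree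
  \<open>i\<close> of the minimal graded free resolution of \<open>M\<close>. That resolution exists for every finitely
  generated graded module and is unique up to isomorphism, so the choice does not matter.
\<close>

definition graded_betti ::
    "(('v::finite, 'k::field) mpoly, 'm) module \<Rightarrow> (int \<Rightarrow> 'm set) \<Rightarrow> nat \<Rightarrow> int \<Rightarrow> nat" where
  "graded_betti M gr i j =
     (let F = (SOME F. minimal_graded_free_resolution M gr F)
      in card {b \<in> gens F i. gdeg F i b = j})"

text \<open>
  The set below is finite for every finitely generated graded module, and nonempty if \<open>M\<close> is
  nonzero.
\<close>

definition regularity ::
    "(('v::finite, 'k::field) mpoly, 'm) module \<Rightarrow> (int \<Rightarrow> 'm set) \<Rightarrow> int" where
  "regularity M gr = Max {j - int i | i j. graded_betti M gr i j \<noteq> 0}"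

abbreviation reg_quotient :: "('v::finite, 'k::field) mpoly set \<Rightarrow> int" where
  "reg_quotient I \<equiv> regularity (quotient_module I) (quotient_grading I)"

end

theory Submission
  imports Defs "HOL-Library.Function_Algebras"
begin

text \<open>
  Write \<open>I(G)\<close> for the edge ideal and \<open>\<nu>(G)\<close> for the matching number. The bound is proved by
  deleting a vertex. For an end \<open>x\<close> of an edge there is a short exact sequence
  \<open>0 \<rightarrow> R/(I(G) : x)(-1) \<rightarrow> R/I(G) \<rightarrow> R/(I(G) + (x)) \<rightarrow> 0\<close>, so
  \<open>reg R/I(G)\<close> is at most the maximum of \<open>reg R/(I(G) : x) + 1\<close> and \<open>reg R/(I(G) + (x))\<close>. Modulo
  variables, \<open>I(G) + (x)\<close> is the edge ideal of \<open>G - x\<close> and \<open>I(G) : x\<close> is the edge ideal of what is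
  left of \<open>G\<close> when \<open>x\<close> and its neighbours \<open>N(x)\<close> are removed. A matching of the latter graph
  stays a matching of \<open>G\<close> when an edge at \<open>x\<close> is added, so its matching number is at most
  \<open>\<nu>(G) - 1\<close>. Induction on the number of edges gives \<open>reg R/I(G) \<le> \<nu>(G)\<close>
  (\<open>edge_ideal_reg\<close>, which allows extra variables as generators and speaks of \<open>I(G)\<close>, whose
  regularity is one more than that of the quotient).

  The homological part is a calculus of bounds. A graded submodule \<open>U\<close> of a free module satisfies
  \<open>reg_upto n r d U\<close> if it has finitely many homogeneous generators of degree at
  most \<open>r\<close> whose syzygies have generators of degree at most \<open>r + 1\<close>, and so on, for \<open>n\<close> steps, with
  some choice of generators at each step. An extension of bounded modules is bounded, by induction on \<open>n\<close>
  (\<open>reg_upto_extension\<close>); so is a quotient of a bounded module by a submodule satisfying the bound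
  \<open>r + 1\<close> (\<open>reg_upto_quotient\<close>); and by Schanuel's argument any homogeneous generators of degree at
  most \<open>r\<close> will do in the definition (\<open>reg_upto_syz\<close>).

  Minimal generators of a bounded module have degree at most \<open>r\<close> (\<open>minimal_gens_degree_le\<close>).
  Together with \<open>reg_upto_syz\<close> this has two consequences. Finitely generated minimal syzygies can be
  chosen at every stage, so a minimal resolution exists (\<open>minimal_resolution_exists\<close>) and the
  graded Betti numbers are those of an actual minimal resolution; here the bound supplies the
  finite generation of every syzygy module. And in every minimal resolution the generators in
  homological degree \<open>i\<close> have degree at most \<open>i + \<nu>(G)\<close>. Their degree is also at least
  \<open>i\<close>, since the nonzero entries of a minimal differential have positive degree; hence the set whose maximum is the regularity is finite, and the maximum is at
  most \<open>\<nu>(G)\<close>.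
\<close>

section \<open>Homogeneous parts of polynomials\<close>

text \<open>
  With the pointwise operations, vectors of polynomials form an abelian group. The rules
  removed here would let the simplifier replace sums of vectors by abstractions.
\<close>

declare plus_fun_apply [simp del] zero_fun_apply [simp del]

type_synonym ('v, 'k) vec = "nat \<Rightarrow> ('v, 'k) mpoly"

text \<open>
  The sum of the terms of \<open>p\<close> whose monomials lie in \<open>B\<close>. Homogeneous components and the
  projection onto a monomial ideal are both of this form.
\<close>
definition poly_part :: "('v \<Rightarrow>\<^sub>0 nat) set \<Rightarrow> ('v, 'k::field) mpoly \<Rightarrow> ('v, 'k) mpoly" where
  "poly_part B p = Poly_Mapping.mapp (\<lambda>m c. c when m \<in> B) p"

lemma lookup_poly_part:
  "Poly_Mapping.lookup (poly_part B p) m = (Poly_Mapping.lookup p m when m \<in> B)"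
  by (auto simp: poly_part_def lookup_mapp when_def in_keys_iff)

lemma keys_poly_part: "Poly_Mapping.keys (poly_part B p) = Poly_Mapping.keys p \<inter> B"
  by (auto simp: in_keys_iff lookup_poly_part when_def split: if_splits)

lemma poly_part_add: "poly_part B (p + q) = poly_part B p + poly_part B q"
  by (rule poly_mapping_eqI) (simp add: lookup_poly_part lookup_add when_def)

lemma poly_part_0 [simp]: "poly_part B 0 = 0"
  by (rule poly_mapping_eqI) (simp add: lookup_poly_part)

lemma poly_part_self: "Poly_Mapping.keys p \<subseteq> B \<Longrightarrow> poly_part B p = p"
  by (rule poly_mapping_eqI) (auto simp: lookup_poly_part when_def in_keys_iff)

lemma poly_part_eq_0: "Poly_Mapping.keys p \<inter> B = {} \<Longrightarrow> poly_part B p = 0"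
  by (rule poly_mapping_eqI) (auto simp: lookup_poly_part when_def in_keys_iff)

lemma poly_part_decomp: "p = poly_part B p + poly_part (- B) p"
  by (rule poly_mapping_eqI) (auto simp: lookup_poly_part lookup_add when_def)

lemma keys_multE:
  fixes p q :: "('v, 'k::field) mpoly"
  assumes "m \<in> Poly_Mapping.keys (p * q)"
  obtains a b where "a \<in> Poly_Mapping.keys p" "b \<in> Poly_Mapping.keys q" "m = a + b"
  using assms keys_mult[of p q] by blast

definition hpart :: "int \<Rightarrow> ('v::finite, 'k::field) mpoly \<Rightarrow> ('v, 'k) mpoly" where
  "hpart D = poly_part {m. int (monom_degree m) = D}"

lemma monom_degree_add: "monom_degree (a + b) = monom_degree a + monom_degree b"
  by (simp add: monom_degree_def lookup_add sum.distrib)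

lemma monom_degree_0 [simp]: "monom_degree 0 = 0"
  by (simp add: monom_degree_def)

lemma monom_degree_eq_0_iff: "monom_degree m = 0 \<longleftrightarrow> m = 0"
proof
  assume "monom_degree m = 0"
  then show "m = 0" by (intro poly_mapping_eqI) (simp add: monom_degree_def)
qed simp

lemma hpart_0 [simp]: "hpart D 0 = 0"
  by (simp add: hpart_def)

lemma hpart_add: "hpart D (p + q) = hpart D p + hpart D q"
  by (simp add: hpart_def poly_part_add)

lemma hpart_in_homog [simp]: "hpart D p \<in> homog_component D"
  by (auto simp: hpart_def homog_component_def keys_poly_part)

lemma homog_iff_hpart: "p \<in> homog_component D \<longleftrightarrow> hpart D p = p"
proof
  assume "p \<in> homog_component D"
  then show "hpart D p = p"
    unfolding hpart_def by (intro poly_part_self) (auto simp: homog_component_def)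
qed (metis hpart_in_homog)

text \<open>
  Split \<open>p\<close> into its component of degree \<open>D - e\<close> and the rest: multiplication by the homogeneous
  \<open>q\<close> sends the first into degree \<open>D\<close>, and no term of the second.
\<close>
lemma hpart_mult:
  assumes q: "hpart e q = q"
  shows "hpart D (p * q) = hpart (D - e) p * q"
proof -
  let ?B = "{m. int (monom_degree m) = D - e}"
  have kq: "int (monom_degree b) = e" if "b \<in> Poly_Mapping.keys q" for b
    using q that by (auto simp: homog_iff_hpart[symmetric] homog_component_def)
  have "p * q = poly_part ?B p * q + poly_part (- ?B) p * q"
    using poly_part_decomp[of p ?B] by (metis distrib_right)
  moreover have "hpart D (poly_part ?B p * q) = poly_part ?B p * q"
    unfolding hpart_def
    by (rule poly_part_self) (auto elim!: keys_multE simp: keys_poly_part monom_degree_add kq)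
  moreover have "hpart D (poly_part (- ?B) p * q) = 0"
    unfolding hpart_def
    by (rule poly_part_eq_0) (auto elim!: keys_multE simp: keys_poly_part monom_degree_add kq)
  ultimately show ?thesis
    by (simp add: hpart_add) (simp add: hpart_def)
qed

lemma hpart_1: "hpart 0 1 = 1"
  unfolding homog_iff_hpart[symmetric] by (simp add: homog_component_def)

lemma hpart_neg: "D < 0 \<Longrightarrow> hpart D p = 0"
  unfolding hpart_def by (rule poly_part_eq_0) auto

lemma hpart_zero_single: "hpart 0 p = Poly_Mapping.single 0 (Poly_Mapping.lookup p 0)"
  by (rule poly_mapping_eqI)
    (auto simp: hpart_def lookup_poly_part when_def lookup_single monom_degree_eq_0_iff)

lemma lookup_mult_0:
  fixes p q :: "('v::finite, 'k::field) mpoly"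
  shows "Poly_Mapping.lookup (p * q) 0 = Poly_Mapping.lookup p 0 * Poly_Mapping.lookup q 0"
proof -
  have "hpart 0 (p * q) = hpart 0 p * hpart 0 q"
  proof -
    let ?B = "{m. int (monom_degree m) = 0}"
    have "p * q = p * hpart 0 q + p * poly_part (- ?B) q"
      using poly_part_decomp[of q ?B] by (metis distrib_left hpart_def)
    moreover have "hpart 0 (p * poly_part (- ?B) q) = 0"
      unfolding hpart_def
      by (rule poly_part_eq_0) (auto elim!: keys_multE simp: keys_poly_part monom_degree_add)
    moreover have "hpart 0 (hpart 0 q) = hpart 0 q"
      by (simp add: homog_iff_hpart[symmetric])
    ultimately show ?thesis
      by (simp add: hpart_add hpart_mult)
  qed
  then have "Poly_Mapping.lookup (hpart 0 (p * q)) 0 = Poly_Mapping.lookup (hpart 0 p * hpart 0 q) 0"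
    by simp
  then show ?thesis
    unfolding hpart_zero_single mult_single by simp
qed

section \<open>Graded free modules\<close>

text \<open>
  All modules are submodules of one ambient module of sequences of polynomials; a free module of
  finite rank is the set of sequences supported on a finite index set.
\<close>
definition scale :: "('v, 'k::field) mpoly \<Rightarrow> ('v, 'k) vec \<Rightarrow> ('v, 'k) vec" where
  "scale p u = (\<lambda>n. p * u n)"

lemma scale_apply: "scale p u n = p * u n"
  by (simp add: scale_def)

lemmas vec_simps = fun_eq_iff plus_fun_apply zero_fun_apply scale_apply

global_interpretation vec: Modules.module scale
  by standard (simp_all add: vec_simps algebra_simps)

lemma sum_vec_apply: "(sum f A :: 'a \<Rightarrow> 'b::comm_monoid_add) n = (\<Sum>a\<in>A. f a n)"
  by (induction A rule: infinite_finite_induct) (auto simp: vec_simps)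

abbreviation linmap :: "(('v, 'k::field) vec \<Rightarrow> ('v, 'k) vec) \<Rightarrow> bool" where
  "linmap \<equiv> Modules.module_hom scale scale"

lemma linmapI:
  assumes "\<And>u v. \<phi> (u + v) = \<phi> u + \<phi> v" "\<And>p u. \<phi> (scale p u) = scale p (\<phi> u)"
  shows "linmap \<phi>"
  using assms vec.module_axioms by (simp add: module_hom_iff)

definition hp :: "(nat \<Rightarrow> int) \<Rightarrow> int \<Rightarrow> ('v::finite, 'k::field) vec \<Rightarrow> ('v, 'k) vec" where
  "hp d D u = (\<lambda>n. hpart (D - d n) (u n))"

lemma hp_apply: "hp d D u n = hpart (D - d n) (u n)"
  by (simp add: hp_def)

lemmas vec_hp_simps = vec_simps hp_apply

lemma hp_add: "hp d D (u + v) = hp d D u + hp d D v"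
  by (simp add: vec_hp_simps hpart_add)

lemma hp_0 [simp]: "hp d D 0 = 0"
  by (simp add: vec_hp_simps)

lemma hp_sum: "hp d D (sum f A) = (\<Sum>a\<in>A. hp d D (f a))"
  by (induction A rule: infinite_finite_induct) (simp_all add: hp_add)

lemma hp_hp [simp]: "hp d D (hp d D u) = hp d D u"
  by (simp add: vec_hp_simps homog_iff_hpart[symmetric])

lemma hp_scale: "hp d e u = u \<Longrightarrow> hp d D (scale p u) = scale (hpart (D - e) p) u"
proof -
  assume u: "hp d e u = u"
  have "hpart (D - d n) (p * u n) = hpart (D - e) p * u n" for n
  proof -
    have "hpart (e - d n) (u n) = u n" using u by (metis hp_apply)
    from hpart_mult[OF this, of "D - d n" p] show ?thesis by simp
  qed
  then show ?thesis by (simp add: vec_hp_simps)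
qed

text \<open>
  A linear map is homogeneous of degree \<open>c\<close> if it commutes with the projections onto the
  components. This is stronger than sending homogeneous vectors to homogeneous ones, because vectors
  of infinite support need not be finite sums of homogeneous ones.
\<close>
definition graded_hom ::
    "(nat \<Rightarrow> int) \<Rightarrow> (nat \<Rightarrow> int) \<Rightarrow> int \<Rightarrow> (('v::finite, 'k::field) vec \<Rightarrow> ('v, 'k) vec) \<Rightarrow> bool" where
  "graded_hom d d' c \<phi> \<longleftrightarrow> linmap \<phi> \<and> (\<forall>D u. hp d' (D + c) (\<phi> u) = \<phi> (hp d D u))"

definition graded_submodule :: "(nat \<Rightarrow> int) \<Rightarrow> ('v::finite, 'k::field) vec set \<Rightarrow> bool" where
  "graded_submodule d U \<longleftrightarrow> vec.subspace U \<and> (\<forall>D. \<forall>u\<in>U. hp d D u \<in> U)"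

definition free :: "nat set \<Rightarrow> ('v, 'k::field) vec set" where
  "free S = {u. \<forall>n. n \<notin> S \<longrightarrow> u n = 0}"

definition comb :: "nat set \<Rightarrow> (nat \<Rightarrow> ('v, 'k::field) vec) \<Rightarrow> ('v, 'k) vec \<Rightarrow> ('v, 'k) vec" where
  "comb S y u = (\<Sum>s\<in>S. scale (u s) (y s))"

lemma comb_apply: "comb S y u n = (\<Sum>s\<in>S. u s * y s n)"
  by (simp add: comb_def sum_vec_apply scale_apply)

lemma linmap_comb: "linmap (comb S y)"
  by (rule linmapI)
    (simp_all add: vec_hp_simps comb_apply algebra_simps sum.distrib sum_distrib_left)

lemma comb_cong:
  assumes "\<And>s. s \<in> S \<Longrightarrow> u s = u' s" "\<And>s. s \<in> S \<Longrightarrow> y s = y' s"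
  shows "comb S y u = comb S y' u'"
  using assms by (simp add: comb_def)

lemma linmap_comb_commute:
  assumes "linmap \<phi>" shows "\<phi> (comb S y u) = comb S (\<phi> \<circ> y) u"
proof -
  interpret f: Modules.module_hom scale scale \<phi> by fact
  show ?thesis by (simp add: comb_def f.sum f.scale)
qed

lemma graded_hom_comb:
  assumes "\<And>s. s \<in> S \<Longrightarrow> hp d (e s) (y s) = y s"
  shows "graded_hom e d 0 (comb S y)"
  unfolding graded_hom_def
proof (intro conjI allI linmap_comb)
  fix D u
  show "hp d (D + 0) (comb S y u) = comb S y (hp e D u)"
    unfolding comb_def hp_sum using assms by (intro sum.cong) (simp_all add: hp_scale hp_apply)
qed

lemma comb_Un:
  assumes "finite S" "finite T" "S \<inter> T = {}"
  shows "comb (S \<union> T) y u = comb S y u + comb T y u"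
  using assms by (simp add: comb_def sum.union_disjoint)

definition restr :: "nat set \<Rightarrow> ('v, 'k::field) vec \<Rightarrow> ('v, 'k) vec" where
  "restr S u = (\<lambda>n. if n \<in> S then u n else 0)"

lemma restr_apply: "restr S u n = (if n \<in> S then u n else 0)"
  by (simp add: restr_def)

lemma restr_in_free: "restr S u \<in> free S"
  by (simp add: restr_def free_def)

lemma restr_free: "u \<in> free S \<Longrightarrow> restr S u = u"
  by (auto simp: restr_def free_def vec_hp_simps)

lemma comb_restr: "S \<subseteq> T \<Longrightarrow> comb S y (restr T u) = comb S y u"
  by (rule comb_cong) (auto simp: restr_def)

lemma graded_hom_restr:
  assumes "\<And>s. s \<in> S \<Longrightarrow> e s = e' s"
  shows "graded_hom e e' 0 (restr S)"
  unfolding graded_hom_def using assms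
  by (auto intro!: linmapI simp: vec_hp_simps restr_apply)

definition unit_vec :: "nat \<Rightarrow> ('v, 'k::field) vec" where
  "unit_vec s = (\<lambda>n. if n = s then 1 else 0)"

lemma comb_unit_vec: "finite S \<Longrightarrow> s \<in> S \<Longrightarrow> comb S y (unit_vec s) = y s"
  by (simp add: vec_hp_simps comb_apply unit_vec_def if_distrib[of "\<lambda>x. x * _"] cong: if_cong)

lemma comb_of_unit_vecs: "finite S \<Longrightarrow> comb S unit_vec u = restr S u"
  by (auto simp: vec_hp_simps comb_apply unit_vec_def restr_def if_distrib[of "\<lambda>x. _ * x"] cong: if_cong)

lemma hp_unit_vec: "hp d (d s) (unit_vec s) = unit_vec s"
  by (simp add: vec_hp_simps unit_vec_def hpart_1)

lemma free_empty: "free {} = {0}"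
  by (auto simp: free_def vec_hp_simps)

lemma graded_submodule_free: "graded_submodule d (free S)"
  by (auto simp: graded_submodule_def free_def vec.subspace_def vec_hp_simps)

lemma graded_submodule_kernel:
  assumes U: "graded_submodule d U" and f: "graded_hom d d' 0 \<phi>"
  shows "graded_submodule d {u \<in> U. \<phi> u = 0}"
proof -
  interpret f: Modules.module_hom scale scale \<phi> using f by (simp add: graded_hom_def)
  have "\<phi> (hp d D u) = 0" if "\<phi> u = 0" for D u
  proof -
    have "\<phi> (hp d D u) = hp d' (D + 0) (\<phi> u)" using f by (simp add: graded_hom_def)
    then show ?thesis using that by simp
  qed
  then show ?thesis using U
    by (auto simp: graded_submodule_def vec.subspace_def f.add f.scale)
qed

definition syz :: "nat set \<Rightarrow> (nat \<Rightarrow> ('v, 'k::field) vec) \<Rightarrow> ('v, 'k) vec set" where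
  "syz S y = {u \<in> free S. comb S y u = 0}"

lemma graded_submodule_syz:
  assumes "\<And>s. s \<in> S \<Longrightarrow> hp d (e s) (y s) = y s"
  shows "graded_submodule e (syz S y)"
  unfolding syz_def
  by (rule graded_submodule_kernel[OF graded_submodule_free graded_hom_comb[OF assms]])

text \<open>
  The generators are indexed by \<open>S\<close> and \<open>e\<close> gives their degrees, so that \<open>comb S y\<close> is a map of
  degree 0 from the free module with basis degrees \<open>e\<close> onto \<open>U\<close>.
\<close>
definition homogeneous_gens ::
    "(nat \<Rightarrow> int) \<Rightarrow> ('v::finite, 'k::field) vec set \<Rightarrow> nat set \<Rightarrow> (nat \<Rightarrow> int) \<Rightarrow> (nat \<Rightarrow> ('v, 'k) vec) \<Rightarrow> bool"
  where
  "homogeneous_gens d U S e y \<longleftrightarrow>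
     finite S \<and> (\<forall>s\<in>S. hp d (e s) (y s) = y s) \<and> U = range (comb S y)"

lemma homogeneous_gens_mem: "homogeneous_gens d U S e y \<Longrightarrow> s \<in> S \<Longrightarrow> y s \<in> U"
  unfolding homogeneous_gens_def using comb_unit_vec by (metis rangeI)

lemma homogeneous_gens_obtain:
  assumes "homogeneous_gens d U S e y" "x \<in> U"
  obtains u where "u \<in> free S" "comb S y u = x"
proof -
  obtain u where "comb S y u = x" using assms by (auto simp: homogeneous_gens_def)
  then show thesis using that[OF restr_in_free, of u] by (simp add: comb_restr)
qed

lemma homogeneous_gens_graded_hom:
  "homogeneous_gens d U S e y \<Longrightarrow> graded_hom e d 0 (comb S y)"
  by (rule graded_hom_comb) (auto simp: homogeneous_gens_def)

lemma range_comb_subset: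
  assumes "vec.subspace U" "\<And>s. s \<in> S \<Longrightarrow> y s \<in> U"
  shows "range (comb S y) \<subseteq> U"
  using assms by (auto simp: comb_def intro!: vec.subspace_sum vec.subspace_scale)

lemma subspace_range_comb: "vec.subspace (range (comb S y))"
  using Modules.module_hom.subspace_image[OF linmap_comb vec.subspace_UNIV] .

section \<open>Regularity bounds\<close>

text \<open>
  The first \<open>n\<close> steps of the statement that \<open>U\<close>, as a submodule of the free module with basis degrees
  \<open>d\<close>, has regularity at most \<open>r\<close>. Cutting off after \<open>n\<close> steps makes induction available; the
  unrestricted bound is the conjunction over all \<open>n\<close>.
\<close>
primrec reg_upto :: "nat \<Rightarrow> int \<Rightarrow> (nat \<Rightarrow> int) \<Rightarrow> ('v::finite, 'k::field) vec set \<Rightarrow> bool" where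
  "reg_upto 0 r d U \<longleftrightarrow> True"
| "reg_upto (Suc n) r d U \<longleftrightarrow>
     (\<exists>S e y. homogeneous_gens d U S e y \<and> (\<forall>s\<in>S. e s \<le> r) \<and> reg_upto n (r + 1) e (syz S y))"

lemma reg_upto_SucI:
  "homogeneous_gens d U S e y \<Longrightarrow> (\<And>s. s \<in> S \<Longrightarrow> e s \<le> r) \<Longrightarrow> reg_upto n (r + 1) e (syz S y) \<Longrightarrow>
    reg_upto (Suc n) r d U"
  by auto

lemma reg_upto_mono: "reg_upto n r d U \<Longrightarrow> r \<le> r' \<Longrightarrow> reg_upto n r' d U"
proof (induction n arbitrary: r r' d U)
  case (Suc n)
  then obtain S e y where *: "homogeneous_gens d U S e y" "\<And>s. s \<in> S \<Longrightarrow> e s \<le> r"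
      "reg_upto n (r + 1) e (syz S y)"
    by auto
  then show ?case
    using Suc.IH[OF *(3), of "r' + 1"] Suc.prems(2)
    by (intro reg_upto_SucI[of d U S e y]) (auto intro: order_trans)
qed simp

text \<open>
  Invariance under isomorphism and degree shift: the images of the generators have the same
  syzygies, only the degrees of the basis change. The induction hypothesis is needed for the identity
  map between the two gradings.
\<close>
lemma reg_upto_image:
  assumes "reg_upto n r d U" "graded_hom d d' c \<phi>" "inj_on \<phi> U"
  shows "reg_upto n (r + c) d' (\<phi> ` U)"
  using assms
proof (induction n arbitrary: r d d' U \<phi>)
  case (Suc n)
  then obtain S e y where *: "homogeneous_gens d U S e y" "\<And>s. s \<in> S \<Longrightarrow> e s \<le> r"
      "reg_upto n (r + 1) e (syz S y)"
    by auto
  have lin: "linmap \<phi>" and gr: "hp d' (D + c) (\<phi> u) = \<phi> (hp d D u)" for D u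
    using Suc.prems(2) by (auto simp: graded_hom_def)
  interpret f: Modules.module_hom scale scale \<phi> by (fact lin)
  have U: "U = range (comb S y)" using *(1) by (simp add: homogeneous_gens_def)
  have comm: "comb S (\<phi> \<circ> y) u = \<phi> (comb S y u)" for u
    by (rule linmap_comb_commute[OF lin, symmetric])
  have "0 \<in> U" unfolding U using subspace_range_comb by (rule vec.subspace_0)
  then have zero: "\<phi> x = 0 \<longleftrightarrow> x = 0" if "x \<in> U" for x
    using inj_onD[OF Suc.prems(3), of x 0] that by auto
  have syz: "syz S (\<phi> \<circ> y) = syz S y"
    using zero by (auto simp: syz_def comm U)
  have "graded_hom e (\<lambda>s. e s + c) c id"
    by (auto simp: graded_hom_def vec_hp_simps intro!: linmapI)
  from Suc.IH[OF *(3) this] have "reg_upto n (r + c + 1) (\<lambda>s. e s + c) (syz S (\<phi> \<circ> y))"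
    unfolding syz by (simp add: algebra_simps)
  moreover have "homogeneous_gens d' (\<phi> ` U) S (\<lambda>s. e s + c) (\<phi> \<circ> y)"
    using *(1) gr by (auto simp: homogeneous_gens_def comm[abs_def])
  ultimately show ?case
    using *(2) by (intro reg_upto_SucI) auto
qed simp

lemma reg_upto_degree_cong:
  assumes "reg_upto n r d U" "U \<subseteq> free S" "\<And>s. s \<in> S \<Longrightarrow> d s = d' s"
  shows "reg_upto n r d' U"
proof -
  have id: "restr S u = u" if "u \<in> U" for u using restr_free assms(2) that by blast
  have "reg_upto n (r + 0) d' (restr S ` U)"
    using id by (intro reg_upto_image[OF assms(1) graded_hom_restr[OF assms(3)]] inj_onI) auto
  then show ?thesis using id by simp
qed

lemma reg_upto_zero: "reg_upto n r d {0}"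
proof (induction n arbitrary: r d)
  case (Suc n)
  have "homogeneous_gens d {0} {} d (\<lambda>_. 0)" "syz {} (\<lambda>_. 0 :: ('a, 'b) vec) = {0}"
    by (auto simp: homogeneous_gens_def syz_def free_empty comb_def)
  with Suc show ?case by (intro reg_upto_SucI) auto
qed simp

lemma homogeneous_gens_free:
  assumes "finite S" shows "homogeneous_gens d (free S) S d unit_vec"
proof -
  have "range (restr S) = (free S :: ('a, 'b) vec set)"
    by (auto intro: restr_in_free) (metis restr_free rangeI)
  then show ?thesis
    using assms by (simp add: homogeneous_gens_def hp_unit_vec comb_of_unit_vecs cong: image_cong)
qed

lemma reg_upto_free:
  assumes "finite S" "\<And>s. s \<in> S \<Longrightarrow> d s \<le> r"
  shows "reg_upto n r d (free S)"
proof (cases n)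
  case (Suc m)
  have "syz S (unit_vec :: nat \<Rightarrow> ('a, 'b) vec) = {0}"
    using assms(1) by (auto simp: syz_def comb_of_unit_vecs restr_free) (auto simp: free_def zero_fun_apply restr_def fun_eq_iff)
  then show ?thesis
    unfolding Suc using assms
    by (intro reg_upto_SucI[OF homogeneous_gens_free]) (auto simp: reg_upto_zero)
qed simp

text \<open>
  Generators can be indexed away from a given finite set, so that two free modules can be put side by
  side in a direct sum. Shifting the indices changes the syzygies by an isomorphism.
\<close>
lemma reg_upto_Suc_fresh:
  assumes "reg_upto (Suc n) r d U" "finite A"
  obtains S e y where "homogeneous_gens d U S e y" "\<And>s. s \<in> S \<Longrightarrow> e s \<le> r"
    "reg_upto n (r + 1) e (syz S y)" "S \<inter> A = {}"
proof -
  from assms(1) obtain S e y where *: "homogeneous_gens d U S e y" "\<And>s. s \<in> S \<Longrightarrow> e s \<le> r"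
      "reg_upto n (r + 1) e (syz S y)"
    by auto
  obtain m where m: "\<And>a. a \<in> A \<Longrightarrow> a < m"
    using assms(2) finite_nat_set_iff_bounded[of A] by auto
  let ?S = "(\<lambda>s. s + m) ` S" and ?e = "\<lambda>s. e (s - m)" and ?y = "\<lambda>s. y (s - m)"
  define \<phi> :: "('a, 'b) vec \<Rightarrow> ('a, 'b) vec" where "\<phi> u = (\<lambda>n. if m \<le> n then u (n - m) else 0)" for u
  have shift: "\<phi> u (s + m) = u s" for u s by (simp add: \<phi>_def)
  have comb: "comb ?S ?y u = comb S y (\<lambda>s. u (s + m))" for u
    unfolding comb_def by (subst sum.reindex) (auto simp: inj_on_def)
  have 1: "homogeneous_gens d U ?S ?e ?y"
  proof -
    have "comb S y u = comb ?S ?y (\<phi> u)" for u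
      unfolding comb shift ..
    then have "range (comb S y) = range (comb ?S ?y)"
      unfolding comb by (auto simp: image_iff)
    then show ?thesis using *(1) by (auto simp: homogeneous_gens_def)
  qed
  have syz: "syz ?S ?y = \<phi> ` syz S y"
  proof (intro equalityI subsetI)
    fix u assume u: "u \<in> syz ?S ?y"
    then have "\<phi> (\<lambda>s. u (s + m)) = u"
      by (force simp: syz_def free_def \<phi>_def fun_eq_iff image_iff)
    moreover have "u (s + m) = 0" if "s \<notin> S" for s
    proof -
      have "s + m \<notin> ?S" using that by auto
      then show ?thesis using u by (simp add: syz_def free_def)
    qed
    then have "(\<lambda>s. u (s + m)) \<in> syz S y"
      using u by (simp add: syz_def free_def comb)
    ultimately show "u \<in> \<phi> ` syz S y" by (metis imageI)
  next
    fix u assume "u \<in> \<phi> ` syz S y"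
    then obtain v where v: "u = \<phi> v" "v \<in> syz S y" by blast
    have "\<phi> v n = 0" if "n \<notin> ?S" for n
    proof (cases "m \<le> n")
      case True
      then have "n - m \<notin> S" using that by (metis imageI le_add_diff_inverse2)
      then show ?thesis using v(2) by (simp add: \<phi>_def syz_def free_def)
    qed (simp add: \<phi>_def)
    then show "u \<in> syz ?S ?y"
      using v by (auto simp: syz_def free_def comb shift)
  qed
  have "graded_hom e ?e 0 \<phi>"
    by (auto simp: graded_hom_def \<phi>_def vec_hp_simps intro!: linmapI)
  moreover have "inj_on \<phi> (syz S y)"
    by (rule inj_onI) (metis shift ext)
  ultimately have 3: "reg_upto n (r + 1) ?e (syz ?S ?y)"
    unfolding syz using reg_upto_image[OF *(3), of ?e 0 \<phi>] by simp
  show thesis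
    by (rule that[OF 1 _ 3]) (use *(2) m in fastforce)+
qed

text \<open>
  Any lift of a homogeneous element can be replaced by its component in the right degree.
\<close>
lemma homogeneous_lift:
  assumes H: "homogeneous_gens d U S e z" and x: "x \<in> U" "hp d D x = x"
  obtains g where "g \<in> free S" "comb S z g = x" "hp e D g = g"
proof -
  obtain u where u: "u \<in> free S" "comb S z u = x" using homogeneous_gens_obtain[OF H x(1)] .
  have "comb S z (hp e D u) = hp d (D + 0) (comb S z u)"
    using homogeneous_gens_graded_hom[OF H] by (simp add: graded_hom_def)
  then show thesis
    using that[of "hp e D u"] u x(2) graded_submodule_free[of e S]
    by (auto simp: graded_submodule_def)
qed

section \<open>Short exact sequences\<close>

text \<open>
  The horseshoe argument for \<open>0 \<rightarrow> ker \<pi> \<rightarrow> U \<rightarrow> \<pi>(U) \<rightarrow> 0\<close>: generators of the kernel together with lifts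
  of generators of the image generate \<open>U\<close>, and their syzygies form again a short exact sequence between
  the syzygies of the two outer modules.
\<close>
lemma reg_upto_extension:
  assumes "graded_submodule d U" "graded_hom d d' 0 \<pi>"
    "reg_upto n r d {u \<in> U. \<pi> u = 0}" "reg_upto n r d' (\<pi> ` U)"
  shows "reg_upto n r d U"
  using assms
proof (induction n arbitrary: r d d' U \<pi>)
  case (Suc n)
  have sub: "vec.subspace U" and hpU: "\<And>D u. u \<in> U \<Longrightarrow> hp d D u \<in> U"
    using Suc.prems(1) by (auto simp: graded_submodule_def)
  have lin: "linmap \<pi>" and gr: "\<And>D u. hp d' D (\<pi> u) = \<pi> (hp d D u)"
    using Suc.prems(2) by (auto simp: graded_hom_def)
  interpret f: Modules.module_hom scale scale \<pi> by (fact lin)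
  let ?A = "{u \<in> U. \<pi> u = 0}"
  obtain S e y where A: "homogeneous_gens d ?A S e y" "\<And>s. s \<in> S \<Longrightarrow> e s \<le> r"
      "reg_upto n (r + 1) e (syz S y)"
    using Suc.prems(3) by auto
  then have finS: "finite S" by (simp add: homogeneous_gens_def)
  obtain T f z where C: "homogeneous_gens d' (\<pi> ` U) T f z" "\<And>s. s \<in> T \<Longrightarrow> f s \<le> r"
      "reg_upto n (r + 1) f (syz T z)" and disj: "T \<inter> S = {}"
    using reg_upto_Suc_fresh[OF Suc.prems(4) finS] by metis
  then have finT: "finite T" by (simp add: homogeneous_gens_def)
  have "\<exists>w. w \<in> U \<and> hp d (f t) w = w \<and> \<pi> w = z t" if t: "t \<in> T" for t
  proof -
    obtain w where w: "w \<in> U" "\<pi> w = z t" using homogeneous_gens_mem[OF C(1) t] by auto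
    have "\<pi> (hp d (f t) w) = z t"
      using gr[of "f t" w] w C(1) t by (simp add: homogeneous_gens_def)
    then show ?thesis using hpU[OF w(1)] by (intro exI[of _ "hp d (f t) w"]) simp
  qed
  then obtain w where w: "\<And>t. t \<in> T \<Longrightarrow> w t \<in> U" "\<And>t. t \<in> T \<Longrightarrow> hp d (f t) (w t) = w t"
      "\<And>t. t \<in> T \<Longrightarrow> \<pi> (w t) = z t"
    by metis
  define h where "h n = (if n \<in> S then e n else f n)" for n
  define Y where "Y n = (if n \<in> S then y n else w n)" for n
  have TS: "t \<notin> S" if "t \<in> T" for t using disj that by blast
  have combY: "comb (S \<union> T) Y u = comb S y u + comb T w u" for u
    unfolding comb_Un[OF finS finT, of Y u, OF Int_commute[THEN trans, OF disj]]
    by (intro arg_cong2[of _ _ _ _ "(+)"] comb_cong) (auto simp: Y_def TS)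
  have yA: "\<pi> (comb S y u) = 0" "comb S y u \<in> U" for u
    using A(1) by (auto simp: homogeneous_gens_def)
  have wC: "\<pi> (comb T w u) = comb T z u" for u
    unfolding linmap_comb_commute[OF lin] by (rule comb_cong) (auto simp: w(3))
  have \<pi>Y: "\<pi> (comb (S \<union> T) Y u) = comb T z u" for u
    by (simp add: combY f.add yA wC)
  have YU: "Y n \<in> U" "hp d (h n) (Y n) = Y n" if "n \<in> S \<union> T" for n
    using that w homogeneous_gens_mem[OF A(1)] A(1)
    by (auto simp: Y_def h_def homogeneous_gens_def)
  have glue: "\<exists>u \<in> free (S \<union> T). restr T u = c \<and> comb (S \<union> T) Y u = x"
    if x: "x \<in> U" and c: "c \<in> free T" "\<pi> x = comb T z c" for x c
  proof -
    have "comb T w c \<in> U" using range_comb_subset[OF sub, of T w] w(1) by blast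
    then have "x - comb T w c \<in> ?A"
      using x sub by (simp add: vec.subspace_diff f.diff wC c(2))
    then obtain a where a: "a \<in> free S" "comb S y a = x - comb T w c"
      using homogeneous_gens_obtain[OF A(1)] by blast
    have "comb S y (a + c) = comb S y a"
      by (rule comb_cong) (use c(1) TS in \<open>auto simp: free_def plus_fun_apply\<close>)
    moreover have "comb T w (a + c) = comb T w c"
      by (rule comb_cong) (use a(1) TS in \<open>auto simp: free_def plus_fun_apply\<close>)
    moreover have "a + c \<in> free (S \<union> T)" using a(1) c(1) by (auto simp: free_def plus_fun_apply)
    moreover have "restr T (a + c) = c"
      using a(1) c(1) TS by (auto simp: free_def plus_fun_apply restr_def fun_eq_iff)
    ultimately show ?thesis
      using a(2) by (intro bexI[of _ "a + c"]) (simp_all add: combY)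
  qed
  have gens: "homogeneous_gens d U (S \<union> T) h Y"
  proof -
    have "range (comb (S \<union> T) Y) \<subseteq> U" using YU by (intro range_comb_subset sub)
    moreover have "x \<in> range (comb (S \<union> T) Y)" if "x \<in> U" for x
    proof -
      have "\<pi> x \<in> \<pi> ` U" using that by simp
      then obtain c where "c \<in> free T" "comb T z c = \<pi> x"
        by (rule homogeneous_gens_obtain[OF C(1)])
      then show ?thesis using glue[OF that, of c] by (metis rangeI)
    qed
    ultimately show ?thesis using finS finT YU by (auto simp: homogeneous_gens_def)
  qed
  let ?K = "syz (S \<union> T) Y"
  have ker: "{u \<in> ?K. restr T u = 0} = syz S y"
  proof (intro equalityI subsetI)
    fix u assume u: "u \<in> {u \<in> ?K. restr T u = 0}"
    then have 0: "u t = 0" if "t \<in> T" for t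
      using that by (auto simp: restr_def zero_fun_apply fun_eq_iff split: if_splits)
    then have "comb T w u = 0" by (simp add: comb_def)
    then show "u \<in> syz S y" using u 0 by (auto simp: syz_def combY free_def)
  next
    fix u assume u: "u \<in> syz S y"
    then have 0: "u t = 0" if "t \<in> T" for t
      using that TS by (auto simp: syz_def free_def)
    then have "comb T w u = 0" "restr T u = 0"
      by (simp_all add: comb_def restr_def fun_eq_iff zero_fun_apply)
    then show "u \<in> {u \<in> ?K. restr T u = 0}"
      using u by (auto simp: syz_def combY free_def)
  qed
  have im: "restr T ` ?K = syz T z"
  proof (intro equalityI subsetI)
    fix c assume "c \<in> restr T ` ?K"
    then obtain u where u: "u \<in> ?K" "c = restr T u" by blast
    then have "comb T z u = 0" using \<pi>Y[of u] by (simp add: syz_def)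
    then show "c \<in> syz T z" using u by (simp add: syz_def restr_in_free comb_restr)
  next
    fix c assume "c \<in> syz T z"
    then have c: "c \<in> free T" "\<pi> 0 = comb T z c" by (simp_all add: syz_def)
    obtain u where "u \<in> free (S \<union> T)" "restr T u = c" "comb (S \<union> T) Y u = 0"
      using glue[OF vec.subspace_0[OF sub] c] by blast
    then have "u \<in> ?K" "c = restr T u" by (auto simp: syz_def)
    then show "c \<in> restr T ` ?K" by blast
  qed
  have grr: "graded_hom h f 0 (restr T)" by (rule graded_hom_restr) (auto simp: h_def TS)
  have "reg_upto n (r + 1) h ?K"
  proof (rule Suc.IH[OF graded_submodule_syz grr])
    show "hp d (h s) (Y s) = Y s" if "s \<in> S \<union> T" for s using YU(2)[OF that] .
    show "reg_upto n (r + 1) h {u \<in> ?K. restr T u = 0}"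
      unfolding ker by (rule reg_upto_degree_cong[OF A(3), of S]) (auto simp: syz_def h_def)
    show "reg_upto n (r + 1) f (restr T ` ?K)"
      unfolding im by (rule C(3))
  qed
  then show ?case
    using A(2) C(2) by (intro reg_upto_SucI[OF gens]) (auto simp: h_def)
qed simp

text \<open>
  The images of generators of \<open>U\<close> generate \<open>\<pi>(U)\<close>. Their syzygies are an extension of the kernel of
  \<open>\<pi>\<close> by the syzygies of \<open>U\<close>, to which \<open>reg_upto_extension\<close> applies.
\<close>
lemma reg_upto_quotient:
  assumes "graded_hom d d' 0 \<pi>" "reg_upto (Suc n) r d U" "reg_upto n (r + 1) d {u \<in> U. \<pi> u = 0}"
  shows "reg_upto (Suc n) r d' (\<pi> ` U)"
proof -
  have lin: "linmap \<pi>" and gr: "\<And>D u. hp d' D (\<pi> u) = \<pi> (hp d D u)"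
    using assms(1) by (auto simp: graded_hom_def)
  obtain S e y where U: "homogeneous_gens d U S e y" "\<And>s. s \<in> S \<Longrightarrow> e s \<le> r"
      "reg_upto n (r + 1) e (syz S y)"
    using assms(2) by auto
  have comm: "comb S (\<pi> \<circ> y) u = \<pi> (comb S y u)" for u
    by (rule linmap_comb_commute[OF lin, symmetric])
  have gens: "homogeneous_gens d' (\<pi> ` U) S e (\<pi> \<circ> y)"
    using U(1) gr by (auto simp: homogeneous_gens_def comm[abs_def])
  let ?K = "syz S (\<pi> \<circ> y)"
  have "comb S y ` ?K = {u \<in> U. \<pi> u = 0}"
  proof (intro equalityI subsetI)
    fix x assume "x \<in> {u \<in> U. \<pi> u = 0}"
    moreover from this obtain u where "u \<in> free S" "comb S y u = x"
      using homogeneous_gens_obtain[OF U(1)] by blast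
    ultimately show "x \<in> comb S y ` ?K" by (auto simp: syz_def comm)
  qed (use U(1) in \<open>auto simp: syz_def comm homogeneous_gens_def\<close>)
  moreover have "{u \<in> ?K. comb S y u = 0} = syz S y"
    using Modules.module_hom.zero[OF lin] by (auto simp: syz_def comm)
  moreover have "graded_submodule e ?K"
    using gens by (intro graded_submodule_syz) (auto simp: homogeneous_gens_def)
  ultimately have "reg_upto n (r + 1) e ?K"
    using reg_upto_extension[OF _ homogeneous_gens_graded_hom[OF U(1)], of ?K n "r + 1"] U(3) assms(3)
    by simp
  then show ?thesis
    using U(2) by (intro reg_upto_SucI[OF gens]) auto
qed

text \<open>
  Schanuel's argument. Let \<open>F\<close> be the free module on \<open>z\<close>, with kernel \<open>K\<close>, and \<open>G\<close> the free module on
  the generators \<open>y\<close> given by the bound, with kernel \<open>N\<close>. The pullback \<open>P\<close> of \<open>F\<close> and \<open>G\<close> over \<open>U\<close> is an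
  extension of \<open>F\<close> by \<open>N\<close>, hence bounded. Lifting \<open>y\<close> along \<open>z\<close> gives a map from \<open>P\<close> onto \<open>K\<close> whose
  kernel is a copy of \<open>G\<close>, so \<open>K\<close> is bounded as a quotient of \<open>P\<close>.
\<close>
theorem reg_upto_syz:
  assumes H: "homogeneous_gens d U S e z" and le: "\<And>s. s \<in> S \<Longrightarrow> e s \<le> r"
    and reg: "reg_upto (Suc n) r d U"
  shows "reg_upto n (r + 1) e (syz S z)"
proof (cases n)
  case (Suc m)
  have finS: "finite S" using H by (simp add: homogeneous_gens_def)
  obtain T f y where T: "homogeneous_gens d U T f y" "\<And>s. s \<in> T \<Longrightarrow> f s \<le> r"
      "reg_upto n (r + 1) f (syz T y)" and disj: "T \<inter> S = {}"
    using reg_upto_Suc_fresh[OF reg finS] by metis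
  then have finT: "finite T" by (simp add: homogeneous_gens_def)
  have TS: "t \<notin> S" if "t \<in> T" for t using disj that by blast
  have "\<exists>g. g \<in> free S \<and> comb S z g = y t \<and> hp e (f t) g = g" if "t \<in> T" for t
    using homogeneous_lift[OF H homogeneous_gens_mem[OF T(1) that], of "f t"] that T(1)
    by (metis homogeneous_gens_def)
  then obtain g where g: "\<And>t. t \<in> T \<Longrightarrow> g t \<in> free S" "\<And>t. t \<in> T \<Longrightarrow> comb S z (g t) = y t"
      "\<And>t. t \<in> T \<Longrightarrow> hp e (f t) (g t) = g t"
    by metis
  define h where "h n = (if n \<in> S then e n else f n)" for n
  \<comment> \<open>The map \<open>(u, v) \<mapsto> u - g(v)\<close>, where \<open>g\<close> lifts \<open>y\<close> along \<open>z\<close>. It restricts to the map from \<open>P\<close> onto \<open>K\<close>.\<close>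
  define Q where "Q n = (if n \<in> S then unit_vec n else - g n)" for n
  define P where "P = syz (S \<union> T) (comb S z \<circ> Q)"
  have hpm: "hp e D (- u) = - hp e D u" for D and u :: "('a, 'b) vec"
    using hp_add[of e D u "- u"] by (simp add: eq_neg_iff_add_eq_0 add.commute)
  have Qhom: "hp e (h n) (Q n) = Q n" if "n \<in> S \<union> T" for n
    using that g(3) by (auto simp: h_def Q_def hp_unit_vec hpm)
  have Qgr: "graded_hom h e 0 (comb (S \<union> T) Q)"
    by (rule graded_hom_comb) (rule Qhom)
  have zgr: "hp d (h n) (comb S z (Q n)) = comb S z (Q n)" if "n \<in> S \<union> T" for n
    using homogeneous_gens_graded_hom[OF H] Qhom[OF that] by (simp add: graded_hom_def)
  have zlin: "linmap (comb S z)" by (rule linmap_comb)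
  interpret zl: Modules.module_hom scale scale "comb S z" by (rule linmap_comb)
  have combP: "comb (S \<union> T) (comb S z \<circ> Q) u = comb S z (comb (S \<union> T) Q u)" for u
    by (rule linmap_comb_commute[OF zlin, symmetric])
  have combQ: "comb (S \<union> T) Q u = restr S u - comb T g u" for u
  proof -
    have "comb S Q u = comb S unit_vec u" by (rule comb_cong) (auto simp: Q_def)
    moreover have "comb T Q u = - comb T g u"
      unfolding comb_def sum_negf[symmetric]
      by (rule sum.cong) (auto simp: Q_def TS vec.scale_minus_right)
    ultimately show ?thesis
      using comb_Un[OF finS finT, of Q u] disj by (simp add: Int_commute comb_of_unit_vecs finS)
  qed
  have combgy: "comb S z (comb T g u) = comb T y u" for u
    unfolding linmap_comb_commute[OF zlin] by (rule comb_cong) (auto simp: g(2))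
  have combP': "comb (S \<union> T) (comb S z \<circ> Q) u = comb S z u - comb T y u" for u
    by (simp add: combP combQ zl.diff combgy comb_restr)
  have gfree: "comb T g u \<in> free S" for u
    using range_comb_subset[of "free S" T g] g(1) graded_submodule_free[of e S]
    by (auto simp: graded_submodule_def)
  have Pgr: "graded_submodule h P"
    unfolding P_def by (rule graded_submodule_syz[where d = d]) (simp add: zgr)
  have regP: "reg_upto n (r + 1) h P"
  proof (rule reg_upto_extension[OF Pgr, of e "restr S"])
    show "graded_hom h e 0 (restr S)" by (rule graded_hom_restr) (simp add: h_def)
    have "{u \<in> P. restr S u = 0} = syz T y"
    proof (intro equalityI subsetI)
      fix u assume u: "u \<in> {u \<in> P. restr S u = 0}"
      then have 0: "u s = 0" if "s \<in> S" for s
        using that by (auto simp: restr_def zero_fun_apply fun_eq_iff split: if_splits)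
      then have "comb S z u = 0" by (simp add: comb_def)
      then show "u \<in> syz T y" using u 0 by (auto simp: P_def syz_def combP' free_def)
    next
      fix u assume u: "u \<in> syz T y"
      then have 0: "u s = 0" if "s \<in> S" for s
        using that TS by (auto simp: syz_def free_def)
      then have "comb S z u = 0" "restr S u = 0"
        by (simp_all add: comb_def restr_def fun_eq_iff zero_fun_apply)
      then show "u \<in> {u \<in> P. restr S u = 0}"
        using u by (auto simp: P_def syz_def combP' free_def)
    qed
    then show "reg_upto n (r + 1) h {u \<in> P. restr S u = 0}"
      using reg_upto_degree_cong[OF T(3), of T h] TS by (auto simp: syz_def h_def)
    have "restr S ` P = free S"
    proof (intro equalityI subsetI)
      fix u assume "u \<in> restr S ` P" then show "u \<in> free S" by (auto intro: restr_in_free)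
    next
      fix u :: "('a, 'b) vec" assume u: "u \<in> free S"
      have "comb S z u \<in> U" using H by (simp add: homogeneous_gens_def)
      then obtain v where v: "v \<in> free T" "comb T y v = comb S z u"
        using homogeneous_gens_obtain[OF T(1)] by blast
      have "comb S z (u + v) = comb S z u"
        by (rule comb_cong) (use v(1) TS in \<open>auto simp: free_def plus_fun_apply\<close>)
      moreover have "comb T y (u + v) = comb T y v"
        by (rule comb_cong) (use u TS in \<open>auto simp: free_def plus_fun_apply\<close>)
      ultimately have "u + v \<in> P"
        using u v by (auto simp: P_def syz_def combP' free_def plus_fun_apply)
      moreover have "restr S (u + v) = u"
        using u v(1) TS by (auto simp: free_def plus_fun_apply restr_def fun_eq_iff)
      ultimately show "u \<in> restr S ` P" by (metis imageI)
    qed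
    then show "reg_upto n (r + 1) e (restr S ` P)"
      using le by (force intro!: reg_upto_free finS)
  qed
  \<comment> \<open>The graph of \<open>g\<close>, a copy of \<open>G\<close>, is the kernel of \<open>Q\<close> on the pullback.\<close>
  define \<psi> where "\<psi> = comb T (\<lambda>t. unit_vec t + g t)"
  have \<psi>: "\<psi> v = restr T v + comb T g v" for v
    unfolding comb_of_unit_vecs[OF finT, symmetric]
    by (simp add: \<psi>_def comb_def vec.scale_right_distrib sum.distrib)
  have hpg: "hp h (f t) (g t) = g t" if t: "t \<in> T" for t
  proof (rule ext)
    fix s show "hp h (f t) (g t) s = g t s"
      using fun_cong[OF g(3)[OF t], of s] g(1)[OF t] by (cases "s \<in> S") (auto simp: hp_apply h_def free_def)
  qed
  have "graded_hom f h 0 \<psi>"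
    unfolding \<psi>_def
  proof (rule graded_hom_comb)
    fix t assume t: "t \<in> T"
    have "h t = f t" using TS[OF t] by (simp add: h_def)
    then show "hp h (f t) (unit_vec t + g t) = unit_vec t + g t"
      using hpg[OF t] hp_unit_vec[of h t] by (simp add: hp_add)
  qed
  moreover have \<psi>T: "restr T (\<psi> v) = restr T v" for v
    using gfree[of v] TS by (auto simp: \<psi> restr_def fun_eq_iff plus_fun_apply free_def)
  then have "inj_on \<psi> (free T)" by (metis inj_onI restr_free)
  ultimately have reg\<psi>: "reg_upto m (r + 1 + 1) h (\<psi> ` free T)"
    using reg_upto_image[OF reg_upto_free[OF finT, of f "r + 1 + 1"], of h 0 \<psi> m] T(2) by force
  have "{u \<in> P. comb (S \<union> T) Q u = 0} = \<psi> ` free T"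
  proof (intro equalityI subsetI)
    fix u assume u: "u \<in> {u \<in> P. comb (S \<union> T) Q u = 0}"
    then have "restr S u = comb T g u" "u \<in> free (S \<union> T)" by (auto simp: combQ P_def syz_def)
    then have "u = restr T u + comb T g u"
      using disj by (metis (no_types, lifting) add.commute combQ restr_free comb_of_unit_vecs comb_Un
        finS finT Int_commute finite_UnI)
    then have "u = \<psi> (restr T u)"
      by (simp add: \<psi> comb_restr restr_free restr_in_free)
    then show "u \<in> \<psi> ` free T" using restr_in_free by blast
  next
    fix u assume "u \<in> \<psi> ` free T"
    then obtain v where v: "u = \<psi> v" "v \<in> free T" by blast
    have 1: "restr S u = comb T g v"
      using v gfree[of v] TS by (auto simp: \<psi> restr_def fun_eq_iff plus_fun_apply free_def)
    have "comb T g u = comb T g v"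
      using \<psi>T[of v] v by (metis comb_restr order_refl)
    then have 2: "comb (S \<union> T) Q u = 0" by (simp add: combQ 1)
    moreover have "u \<in> free (S \<union> T)"
      using v gfree[of v] by (auto simp: \<psi> plus_fun_apply free_def restr_def)
    ultimately show "u \<in> {u \<in> P. comb (S \<union> T) Q u = 0}"
      by (simp add: P_def syz_def combP)
  qed
  with reg\<psi> have "reg_upto n (r + 1) e (comb (S \<union> T) Q ` P)"
    using reg_upto_quotient[OF Qgr, of m "r + 1" P] regP Suc by simp
  moreover have "comb (S \<union> T) Q ` P = syz S z"
  proof (intro equalityI subsetI)
    fix x assume "x \<in> comb (S \<union> T) Q ` P"
    then obtain u where u: "u \<in> P" "x = comb (S \<union> T) Q u" by blast
    then have "comb S z x = 0" by (simp add: P_def syz_def combP)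
    moreover have "x \<in> free S"
      using u(2) gfree[of u] restr_in_free[of S u] by (auto simp: combQ free_def)
    ultimately show "x \<in> syz S z" by (simp add: syz_def)
  next
    fix x assume x: "x \<in> syz S z"
    then have "x t = 0" if "t \<in> T" for t using that TS by (auto simp: syz_def free_def)
    then have 0: "comb T g x = 0" "comb T y x = 0" by (simp_all add: comb_def)
    then have "x \<in> P" using x by (auto simp: P_def syz_def combP' free_def)
    moreover have "comb (S \<union> T) Q x = x" using x by (simp add: combQ 0 syz_def restr_free)
    ultimately show "x \<in> comb (S \<union> T) Q ` P" by (metis imageI)
  qed
  ultimately show ?thesis by simp
qed simp

section \<open>Minimal generators\<close>

definition minimal_gens :: "nat set \<Rightarrow> (nat \<Rightarrow> ('v, 'k::field) vec) \<Rightarrow> bool" where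
  "minimal_gens S y \<longleftrightarrow> (\<forall>u\<in>syz S y. \<forall>s. Poly_Mapping.lookup (u s) 0 = 0)"

text \<open>
  The elements of \<open>U\<close> of degree at most \<open>r\<close> are combinations of the \<open>z s\<close> of degree at most \<open>r\<close>. As they
  generate \<open>U\<close>, a generator of larger degree would be a combination of the others, which is a syzygy with a
  coefficient 1.
\<close>
theorem minimal_gens_degree_le:
  assumes H: "homogeneous_gens d U S e z" and min: "minimal_gens S z"
    and reg: "reg_upto (Suc n) r d U" and s: "s \<in> S"
  shows "e s \<le> r"
proof (rule ccontr)
  assume "\<not> e s \<le> r"
  have finS: "finite S" using H by (simp add: homogeneous_gens_def)
  obtain T f y where T: "homogeneous_gens d U T f y" "\<And>s. s \<in> T \<Longrightarrow> f s \<le> r"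
    using reg by auto
  have "\<exists>g. g \<in> free S \<and> comb S z g = y t \<and> hp e (f t) g = g" if "t \<in> T" for t
    using homogeneous_lift[OF H homogeneous_gens_mem[OF T(1) that], of "f t"] that T(1)
    by (metis homogeneous_gens_def)
  then obtain g where g: "\<And>t. t \<in> T \<Longrightarrow> g t \<in> free S" "\<And>t. t \<in> T \<Longrightarrow> comb S z (g t) = y t"
      "\<And>t. t \<in> T \<Longrightarrow> hp e (f t) (g t) = g t"
    by metis
  have gs: "g t s = 0" if "t \<in> T" for t
  proof -
    have "f t - e s < 0" using T(2)[OF that] \<open>\<not> e s \<le> r\<close> by simp
    then show ?thesis using fun_cong[OF g(3)[OF that], of s] by (simp add: hp_apply hpart_neg)
  qed
  obtain u where u: "comb T y u = z s"
    using homogeneous_gens_obtain[OF T(1) homogeneous_gens_mem[OF H s]] .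
  define v where "v = comb T g u"
  have vs: "v s = 0" by (simp add: v_def comb_apply gs)
  have vfree: "v \<in> free S"
    using range_comb_subset[of "free S" T g] g(1) graded_submodule_free[of e S]
    by (auto simp: graded_submodule_def v_def)
  have "comb S z v = comb T y u"
    unfolding v_def linmap_comb_commute[OF linmap_comb] by (rule comb_cong) (auto simp: g(2))
  then have "comb S z (unit_vec s - v) = 0"
    by (simp add: Modules.module_hom.diff[OF linmap_comb] comb_unit_vec finS s u)
  moreover have "unit_vec s - v \<in> free S"
    using vfree s by (auto simp: free_def unit_vec_def)
  ultimately have "Poly_Mapping.lookup ((unit_vec s - v) s) 0 = 0"
    using min by (auto simp: minimal_gens_def syz_def)
  then show False by (simp add: unit_vec_def vs)
qed

text \<open>
  Take a generating subset of least size. If a syzygy had a coefficient with nonzero constant term,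
  its homogeneous component in the degree of that generator would have a nonzero constant as coefficient
  there, and the generator could be dropped.
\<close>
lemma minimal_gens_exist:
  assumes "homogeneous_gens d U S e y"
  obtains S' where "homogeneous_gens d U S' e y" "minimal_gens S' y" "S' \<subseteq> S"
proof -
  obtain S' where H: "homogeneous_gens d U S' e y" and sub: "S' \<subseteq> S"
    and least: "\<And>T. homogeneous_gens d U T e y \<Longrightarrow> T \<subseteq> S \<Longrightarrow> card S' \<le> card T"
    using ex_has_least_nat[of "\<lambda>T. homogeneous_gens d U T e y \<and> T \<subseteq> S" S card] assms by blast
  have fin: "finite S'" using H by (simp add: homogeneous_gens_def)
  have "minimal_gens S' y"
  proof (rule ccontr)
    assume "\<not> minimal_gens S' y"
    then obtain u s where u: "u \<in> syz S' y" and s0: "Poly_Mapping.lookup (u s) 0 \<noteq> 0"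
      by (auto simp: minimal_gens_def)
    define c where "c = Poly_Mapping.lookup (u s) 0"
    have s: "s \<in> S'" using u s0 by (auto simp: syz_def free_def)
    \<comment> \<open>In this component the coefficient of \<open>y s\<close> has degree 0, so it is the constant \<open>c\<close>.\<close>
    define v where "v = hp e (e s) u"
    have "graded_submodule e (syz S' y)"
      by (rule graded_submodule_syz[where d = d]) (use H in \<open>simp add: homogeneous_gens_def\<close>)
    then have "v \<in> syz S' y" using u by (simp add: graded_submodule_def v_def)
    then have "comb S' y v = 0" by (simp add: syz_def)
    then have "scale (v s) (y s) + comb (S' - {s}) y v = 0"
      unfolding comb_def using sum.remove[OF fin s, of "\<lambda>s. scale (v s) (y s)"] by simp
    moreover have vs: "v s = Poly_Mapping.single 0 c"
      by (simp add: v_def hp_apply hpart_zero_single c_def)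
    moreover have "scale (Poly_Mapping.single 0 (inverse c)) (scale (v s) (y s)) = y s"
      using s0 by (simp add: vs vec.scale_scale mult_single c_def)
    ultimately have y_s: "y s = scale (- Poly_Mapping.single 0 (inverse c)) (comb (S' - {s}) y v)"
      by (metis add_eq_0_iff vec.scale_minus_left vec.scale_minus_right minus_minus)
    then have ys: "y s \<in> range (comb (S' - {s}) y)"
      unfolding y_s by (intro vec.subspace_scale[OF subspace_range_comb] rangeI)
    have "y t \<in> range (comb (S' - {s}) y)" if "t \<in> S'" for t
    proof (cases "t = s")
      case False
      then show ?thesis using that comb_unit_vec[of "S' - {s}" t y] fin by (metis finite_Diff Diff_iff rangeI singletonD)
    qed (use ys in simp)
    then have "U \<subseteq> range (comb (S' - {s}) y)"
      using H range_comb_subset[OF subspace_range_comb, of S' y "S' - {s}" y]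
      by (simp add: homogeneous_gens_def)
    moreover have "range (comb (S' - {s}) y) \<subseteq> U"
      using homogeneous_gens_mem[OF H] H subspace_range_comb[of S' y]
      by (intro range_comb_subset) (auto simp: homogeneous_gens_def)
    ultimately have "homogeneous_gens d U (S' - {s}) e y"
      using H by (auto simp: homogeneous_gens_def)
    from least[OF this] show False
      using fin s sub by (metis card_Diff1_less leD Diff_subset order_trans)
  qed
  then show thesis using that H sub by blast
qed

section \<open>Monomial ideals\<close>

lemma lookup_single_mult:
  fixes p :: "('v, 'k::field) mpoly"
  shows "Poly_Mapping.lookup (Poly_Mapping.single t 1 * p) (t + m) = Poly_Mapping.lookup p m"
  by (simp add: lookup_mult lookup_single when_mult)

lemma keys_single_mult:
  fixes p :: "('v, 'k::field) mpoly"
  shows "Poly_Mapping.keys (Poly_Mapping.single t 1 * p) = (+) t ` Poly_Mapping.keys p"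
proof
  show "Poly_Mapping.keys (Poly_Mapping.single t 1 * p) \<subseteq> (+) t ` Poly_Mapping.keys p"
    by (auto elim!: keys_multE simp: keys_single)
qed (auto simp: in_keys_iff lookup_single_mult)

lemma single_dvd:
  fixes p :: "('v, 'k::field) mpoly"
  assumes "Poly_Mapping.keys p \<subseteq> range ((+) t)"
  obtains q where "p = Poly_Mapping.single t 1 * q"
proof
  let ?q = "Poly_Mapping.map_key ((+) t) p"
  show "p = Poly_Mapping.single t 1 * ?q"
  proof (rule poly_mapping_eqI)
    fix k
    show "Poly_Mapping.lookup p k = Poly_Mapping.lookup (Poly_Mapping.single t 1 * ?q) k"
    proof (cases "k \<in> range ((+) t)")
      case True
      then show ?thesis by (auto simp: lookup_single_mult map_key.rep_eq inj_on_def)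
    next
      case False
      then have "k \<notin> Poly_Mapping.keys p" "k \<notin> Poly_Mapping.keys (Poly_Mapping.single t 1 * ?q)"
        using assms by (auto simp: keys_single_mult)
      then show ?thesis by (simp add: in_keys_iff)
    qed
  qed
qed

lemma monom_split:
  fixes m t :: "'v \<Rightarrow>\<^sub>0 nat"
  assumes "\<And>v. Poly_Mapping.lookup t v \<le> Poly_Mapping.lookup m v"
  shows "m = t + (m - t)"
  using assms by (intro poly_mapping_eqI) (simp add: lookup_add lookup_minus)

text \<open>
  Monomial ideals correspond to the sets of monomials closed under multiplication. Colon ideals and sums
  then become operations on sets of exponent vectors.
\<close>
definition upset :: "('v \<Rightarrow>\<^sub>0 nat) set \<Rightarrow> bool" where
  "upset B \<longleftrightarrow> (\<forall>m\<in>B. \<forall>m'. m' + m \<in> B)"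

definition monom_ideal :: "('v \<Rightarrow>\<^sub>0 nat) set \<Rightarrow> ('v, 'k::field) mpoly set" where
  "monom_ideal B = {p. Poly_Mapping.keys p \<subseteq> B}"

lemma monom_ideal_0: "0 \<in> monom_ideal B"
  by (simp add: monom_ideal_def)

lemma monom_ideal_add: "p \<in> monom_ideal B \<Longrightarrow> q \<in> monom_ideal B \<Longrightarrow> p + q \<in> monom_ideal B"
  using keys_add[of p q] by (auto simp: monom_ideal_def)

lemma monom_ideal_mult: "upset B \<Longrightarrow> q \<in> monom_ideal B \<Longrightarrow> p * q \<in> monom_ideal B"
  by (auto simp: monom_ideal_def upset_def elim!: keys_multE)

lemma monom_ideal_uminus: "upset B \<Longrightarrow> p \<in> monom_ideal B \<Longrightarrow> - p \<in> monom_ideal B"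
  using monom_ideal_mult[of B p "- 1"] by simp

lemma monom_ideal_poly_part: "p \<in> monom_ideal B \<Longrightarrow> poly_part A p \<in> monom_ideal B"
  by (auto simp: monom_ideal_def keys_poly_part)

definition xdeg :: "'v \<Rightarrow> ('v \<Rightarrow>\<^sub>0 nat)" where
  "xdeg v = Poly_Mapping.single v 1"

lemma pvar_eq: "pvar v = Poly_Mapping.single (xdeg v) 1"
  by (simp add: pvar_def xdeg_def)

lemma lookup_xdeg: "Poly_Mapping.lookup (xdeg v) w = (if w = v then 1 else 0)"
  by (simp add: xdeg_def lookup_single when_def)

lemma pos_eq_range: "{m :: 'v \<Rightarrow>\<^sub>0 nat. 0 < Poly_Mapping.lookup m x} = range ((+) (xdeg x))"
proof (intro equalityI subsetI)
  fix m :: "'v \<Rightarrow>\<^sub>0 nat" assume "m \<in> {m. 0 < Poly_Mapping.lookup m x}"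
  then have "m = xdeg x + (m - xdeg x)"
    by (intro monom_split) (auto simp: lookup_xdeg)
  then show "m \<in> range ((+) (xdeg x))" by (rule range_eqI)
qed (auto simp: lookup_add lookup_xdeg)

lemma pvar_mult_mem: "pvar x * p \<in> monom_ideal B \<longleftrightarrow> p \<in> monom_ideal {m. xdeg x + m \<in> B}"
  by (auto simp: monom_ideal_def pvar_eq keys_single_mult)

lemma hpart_pvar: "hpart 1 (pvar x) = pvar x"
proof -
  have "monom_degree (xdeg x) = 1"
    by (simp add: monom_degree_def lookup_xdeg)
  then show ?thesis
    unfolding homog_iff_hpart[symmetric] by (simp add: homog_component_def pvar_eq)
qed

lemma hpart_pvar_mult: "hpart D (pvar x * p) = pvar x * hpart (D - 1) p"
  using hpart_mult[OF hpart_pvar, of D p x] by (simp add: mult.commute)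

text \<open>
  The terms of \<open>p\<close> outside \<open>B\<close> are all divisible by \<open>x\<close>.
\<close>
lemma monom_ideal_Un_pos:
  fixes p :: "('v, 'k::field) mpoly"
  assumes "upset B"
  shows "p \<in> monom_ideal (B \<union> {m. 0 < Poly_Mapping.lookup m x}) \<longleftrightarrow>
    (\<exists>a b. a \<in> monom_ideal B \<and> p = a + pvar x * b)"
proof
  assume p: "p \<in> monom_ideal (B \<union> {m. 0 < Poly_Mapping.lookup m x})"
  have "Poly_Mapping.keys (poly_part (- B) p) \<subseteq> range ((+) (xdeg x))"
    using p unfolding pos_eq_range by (auto simp: monom_ideal_def keys_poly_part)
  then obtain b where "poly_part (- B) p = pvar x * b"
    using single_dvd unfolding pvar_eq by metis
  then have "p = poly_part B p + pvar x * b" using poly_part_decomp by metis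
  moreover have "poly_part B p \<in> monom_ideal B" by (simp add: monom_ideal_def keys_poly_part)
  ultimately show "\<exists>a b. a \<in> monom_ideal B \<and> p = a + pvar x * b" by blast
next
  assume "\<exists>a b. a \<in> monom_ideal B \<and> p = a + pvar x * b"
  then obtain a b where ab: "a \<in> monom_ideal B" "p = a + pvar x * b" by blast
  have "pvar x * b \<in> monom_ideal (B \<union> {m. 0 < Poly_Mapping.lookup m x})"
    unfolding pvar_mult_mem by (auto simp: monom_ideal_def lookup_add lookup_xdeg)
  moreover have "a \<in> monom_ideal (B \<union> {m. 0 < Poly_Mapping.lookup m x})"
    using ab(1) by (auto simp: monom_ideal_def)
  ultimately show "p \<in> monom_ideal (B \<union> {m. 0 < Poly_Mapping.lookup m x})"
    unfolding ab(2) by (rule monom_ideal_add[rotated])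
qed

text \<open>
  The embedding of \<open>R\<close> as the free module of rank 1 with basis vector of index 0.
\<close>
definition emb :: "('v, 'k::field) mpoly \<Rightarrow> ('v, 'k) vec" where
  "emb p = (\<lambda>n. if n = 0 then p else 0)"

lemma emb_simps [simp]: "emb p 0 = p" "emb p (Suc n) = 0"
  by (simp_all add: emb_def)

lemma emb_eq_iff [simp]: "emb p = emb q \<longleftrightarrow> p = q"
  by (metis emb_simps(1))

lemma emb_0: "emb 0 = 0"
  by (simp add: emb_def fun_eq_iff zero_fun_apply)

lemma emb_eq_0: "emb p = 0 \<longleftrightarrow> p = 0"
  by (metis emb_0 emb_eq_iff)

text \<open>
  The type argument fixes the coefficient field, which does not occur in the set of monomials.
\<close>
definition ideal_reg_upto :: "'k::field itself \<Rightarrow> nat \<Rightarrow> int \<Rightarrow> ('v::finite \<Rightarrow>\<^sub>0 nat) set \<Rightarrow> bool" where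
  "ideal_reg_upto K n r B \<longleftrightarrow> reg_upto n r (\<lambda>_. 0) (emb ` (monom_ideal B :: ('v, 'k) mpoly set))"

lemma ideal_reg_upto_mono: "ideal_reg_upto K n r B \<Longrightarrow> r \<le> r' \<Longrightarrow> ideal_reg_upto K n r' B"
  unfolding ideal_reg_upto_def by (rule reg_upto_mono)

text \<open>
  For a monomial ideal \<open>J\<close> and a variable \<open>x\<close>, the map \<open>(a, b) \<mapsto> a + x b\<close> gives the exact sequence
  \<open>0 \<rightarrow> (J : x)(-1) \<rightarrow> J \<oplus> R(-1) \<rightarrow> J + (x) \<rightarrow> 0\<close>. Since \<open>J\<close> is the quotient of the middle module by the
  free module \<open>R(-1)\<close>, bounds can be carried from \<open>J : x\<close> and \<open>J\<close> to \<open>J + (x)\<close> (\<open>adjoin_variable\<close>) and from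
  \<open>J : x\<close> and \<open>J + (x)\<close> to \<open>J\<close> (\<open>remove_variable\<close>).
\<close>
locale colon_sequence =
  fixes K :: "'k::field itself" and B :: "('v::finite \<Rightarrow>\<^sub>0 nat) set" and x :: 'v
  assumes upset: "upset B"
begin

abbreviation "colon \<equiv> {m. xdeg x + m \<in> B}"
abbreviation "adjoin \<equiv> B \<union> {m. 0 < Poly_Mapping.lookup m x}"

definition deg2 :: "nat \<Rightarrow> int" where "deg2 n = (if n = 1 then 1 else 0)"

definition middle :: "('v, 'k) vec set" where
  "middle = {u \<in> free {0, 1}. u 0 \<in> monom_ideal B}"

definition to_sum :: "('v, 'k) vec \<Rightarrow> ('v, 'k) vec" where
  "to_sum u = emb (u 0 + pvar x * u 1)"

definition to_ideal :: "('v, 'k) vec \<Rightarrow> ('v, 'k) vec" where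
  "to_ideal u = emb (u 0)"

definition from_colon :: "('v, 'k) vec \<Rightarrow> ('v, 'k) vec" where
  "from_colon w = (\<lambda>n. if n = 0 then - (pvar x * w 0) else if n = 1 then w 0 else 0)"

lemma graded_hom_to_sum: "graded_hom deg2 (\<lambda>_. 0) 0 to_sum"
  by (auto simp: graded_hom_def to_sum_def deg2_def vec_hp_simps emb_def hpart_add hpart_pvar_mult
      algebra_simps intro!: linmapI)

lemma graded_hom_to_ideal: "graded_hom deg2 (\<lambda>_. 0) 0 to_ideal"
  by (auto simp: graded_hom_def to_ideal_def deg2_def vec_hp_simps emb_def intro!: linmapI)

lemma hpart_uminus: "hpart D (- p) = - hpart D (p :: ('v, 'k) mpoly)"
  using hpart_add[of D p "- p"] by (simp add: eq_neg_iff_add_eq_0 add.commute)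

lemma graded_hom_from_colon: "graded_hom (\<lambda>_. 0) deg2 1 from_colon"
  by (auto simp: graded_hom_def from_colon_def deg2_def vec_hp_simps hpart_uminus hpart_pvar_mult
      distrib_left mult.left_commute intro!: linmapI)

lemma graded_middle: "graded_submodule deg2 middle"
proof -
  have "hpart D p \<in> monom_ideal B" if "p \<in> monom_ideal B" for D and p :: "('v, 'k) mpoly"
    using that by (simp add: hpart_def monom_ideal_poly_part)
  then show ?thesis
    using upset
    by (auto simp: graded_submodule_def vec.subspace_def middle_def free_def vec_hp_simps
        monom_ideal_0 monom_ideal_add monom_ideal_mult)
qed

lemma to_ideal_image: "to_ideal ` middle = emb ` monom_ideal B"
proof (intro equalityI subsetI)
  fix y :: "('v, 'k) vec" assume "y \<in> emb ` monom_ideal B"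
  then obtain p where p: "p \<in> monom_ideal B" "y = emb p" by blast
  then have "emb p \<in> middle" "to_ideal (emb p) = y"
    by (auto simp: middle_def free_def emb_def to_ideal_def)
  then show "y \<in> to_ideal ` middle" by (metis imageI)
qed (auto simp: to_ideal_def middle_def)

lemma to_ideal_kernel: "{u \<in> middle. to_ideal u = 0} = free {1}"
proof (intro equalityI subsetI)
  fix u :: "('v, 'k) vec" assume "u \<in> free {1}"
  then have "u 0 = 0" "u \<in> free {0, 1}" by (simp_all add: free_def)
  then show "u \<in> {u \<in> middle. to_ideal u = 0}"
    by (simp add: middle_def to_ideal_def emb_eq_0 monom_ideal_0)
next
  fix u assume "u \<in> {u \<in> middle. to_ideal u = 0}"
  then have "u 0 = 0" "u \<in> free {0, 1}"
    by (simp_all add: middle_def to_ideal_def emb_eq_0)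
  then have "u n = 0" if "n \<noteq> 1" for n using that by (cases "n = 0") (auto simp: free_def)
  then show "u \<in> free {1}" by (simp add: free_def)
qed

lemma to_sum_image: "to_sum ` middle = emb ` monom_ideal adjoin"
proof (intro equalityI subsetI)
  fix y assume "y \<in> to_sum ` middle"
  then show "y \<in> emb ` monom_ideal adjoin"
    unfolding to_sum_def middle_def using monom_ideal_Un_pos[OF upset, of _ x] by blast
next
  fix y :: "('v, 'k) vec" assume "y \<in> emb ` monom_ideal adjoin"
  then obtain p where p: "p \<in> monom_ideal adjoin" "y = emb p" by blast
  then obtain a b where ab: "a \<in> monom_ideal B" "p = a + pvar x * b"
    using monom_ideal_Un_pos[OF upset, of p x] by blast
  define u where "u n = (if n = 0 then a else if n = 1 then b else 0)" for n :: nat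
  have "u \<in> middle" "to_sum u = y"
    using p ab by (auto simp: u_def middle_def free_def to_sum_def)
  then show "y \<in> to_sum ` middle" by (metis imageI)
qed

lemma to_sum_kernel: "{u \<in> middle. to_sum u = 0} = from_colon ` emb ` monom_ideal colon"
proof (intro equalityI subsetI)
  fix u assume "u \<in> {u \<in> middle. to_sum u = 0}"
  then have u: "u \<in> free {0, 1}" "u 0 \<in> monom_ideal B" "u 0 + pvar x * u 1 = 0"
    by (simp_all add: to_sum_def middle_def emb_eq_0)
  then have u0: "u 0 = - (pvar x * u 1)" by (simp add: eq_neg_iff_add_eq_0)
  then have "pvar x * u 1 \<in> monom_ideal B"
    using monom_ideal_uminus[OF upset u(2)] by simp
  then have "u 1 \<in> monom_ideal colon" by (simp add: pvar_mult_mem)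
  moreover have "u = from_colon (emb (u 1))"
    using u(1) u0 by (auto simp: from_colon_def fun_eq_iff free_def)
  ultimately show "u \<in> from_colon ` emb ` monom_ideal colon" by blast
next
  fix u assume "u \<in> from_colon ` emb ` monom_ideal colon"
  then obtain p where p: "p \<in> monom_ideal colon" "u = from_colon (emb p)" by blast
  then have "- (pvar x * p) \<in> monom_ideal B"
    by (intro monom_ideal_uminus[OF upset]) (simp add: pvar_mult_mem)
  then show "u \<in> {u \<in> middle. to_sum u = 0}"
    using p(2) by (auto simp: middle_def to_sum_def from_colon_def free_def emb_0)
qed

lemma reg_to_sum_kernel:
  assumes "ideal_reg_upto K n r colon"
  shows "reg_upto n (r + 1) deg2 {u \<in> middle. to_sum u = 0}"
  unfolding to_sum_kernel
proof (rule reg_upto_image[OF _ graded_hom_from_colon])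
  show "reg_upto n r (\<lambda>_. 0) (emb ` (monom_ideal colon :: ('v, 'k) mpoly set))"
    using assms by (simp add: ideal_reg_upto_def)
  show "inj_on from_colon (emb ` monom_ideal colon)"
  proof (rule inj_onI)
    fix u v assume "u \<in> emb ` monom_ideal colon" "v \<in> emb ` monom_ideal colon"
      "from_colon u = from_colon v"
    then show "u = v" by (auto dest!: fun_cong[where x = 1] simp: from_colon_def)
  qed
qed

text \<open>
  Here \<open>J \<oplus> R(-1)\<close> is bounded because \<open>J\<close> is, and \<open>J + (x)\<close> is its quotient by \<open>(J : x)(-1)\<close>, for
  which the shift provides the bound \<open>r + 1\<close>.
\<close>
lemma adjoin_variable:
  assumes "ideal_reg_upto K (Suc n) r B" "ideal_reg_upto K n r colon" "1 \<le> r"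
  shows "ideal_reg_upto K (Suc n) r adjoin"
proof -
  have "reg_upto (Suc n) r deg2 middle"
  proof (rule reg_upto_extension[OF graded_middle graded_hom_to_ideal])
    show "reg_upto (Suc n) r deg2 {u \<in> middle. to_ideal u = 0}"
      unfolding to_ideal_kernel using assms(3) by (intro reg_upto_free) (auto simp: deg2_def)
    show "reg_upto (Suc n) r (\<lambda>_. 0) (to_ideal ` middle)"
      using assms(1) unfolding to_ideal_image ideal_reg_upto_def .
  qed
  from reg_upto_quotient[OF graded_hom_to_sum this reg_to_sum_kernel[OF assms(2)]]
  show ?thesis unfolding to_sum_image ideal_reg_upto_def .
qed

text \<open>
  Here \<open>J \<oplus> R(-1)\<close> is bounded as an extension of \<open>J + (x)\<close> by \<open>(J : x)(-1)\<close>, and \<open>J\<close> is its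
  quotient by \<open>R(-1)\<close>. The shift by 1 on \<open>J : x\<close> is what the matching number has to pay for.
\<close>
lemma remove_variable:
  assumes "ideal_reg_upto K n r adjoin" "ideal_reg_upto K n (r - 1) colon" "1 \<le> r"
  shows "ideal_reg_upto K n r B"
proof (cases n)
  case (Suc m)
  have "reg_upto n r deg2 middle"
  proof (rule reg_upto_extension[OF graded_middle graded_hom_to_sum])
    show "reg_upto n r deg2 {u \<in> middle. to_sum u = 0}"
      using reg_to_sum_kernel[OF assms(2)] by simp
    show "reg_upto n r (\<lambda>_. 0) (to_sum ` middle)"
      using assms(1) unfolding to_sum_image ideal_reg_upto_def .
  qed
  moreover have "reg_upto m (r + 1) deg2 {u \<in> middle. to_ideal u = 0}"
    unfolding to_ideal_kernel using assms(3) by (intro reg_upto_free) (auto simp: deg2_def)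
  ultimately show ?thesis
    using reg_upto_quotient[OF graded_hom_to_ideal, of m r middle]
    unfolding to_ideal_image ideal_reg_upto_def Suc by blast
qed (simp add: ideal_reg_upto_def)

end

section \<open>Edge ideals and matchings\<close>

text \<open>
  The monomials of the ideal generated by the edges in \<open>E\<close> and the variables in \<open>V\<close>. The variables are
  needed because passing to colon ideals and adding variables leaves the class of edge ideals.
\<close>
definition edge_monoms :: "'v set set \<Rightarrow> 'v set \<Rightarrow> ('v \<Rightarrow>\<^sub>0 nat) set" where
  "edge_monoms E V = {m. (\<exists>v\<in>V. 0 < Poly_Mapping.lookup m v) \<or>
     (\<exists>e\<in>E. \<forall>v\<in>e. 0 < Poly_Mapping.lookup m v)}"

lemma upset_edge_monoms: "upset (edge_monoms E V)"
  unfolding upset_def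
proof (intro ballI allI)
  fix m m' :: "'a \<Rightarrow>\<^sub>0 nat"
  assume "m \<in> edge_monoms E V"
  moreover have "0 < Poly_Mapping.lookup (m' + m) v" if "0 < Poly_Mapping.lookup m v" for v
    using that by (simp add: lookup_add)
  ultimately show "m' + m \<in> edge_monoms E V"
    unfolding edge_monoms_def by blast
qed

lemma edge_monoms_adjoin:
  "edge_monoms E V \<union> {m. 0 < Poly_Mapping.lookup m x} = edge_monoms {e \<in> E. x \<notin> e} (insert x V)"
  unfolding edge_monoms_def by blast

text \<open>
  An ideal generated by variables has a linear resolution: for a new variable \<open>x\<close> the colon ideal by
  \<open>x\<close> is the ideal itself, so \<open>adjoin_variable\<close> applies.
\<close>
lemma variables_reg: "ideal_reg_upto K n 1 (edge_monoms {} V)" for V :: "'v::finite set"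
proof -
  have "finite V" by simp
  then show ?thesis
  proof (induction V arbitrary: n)
    case empty
    have "emb ` monom_ideal {} = ({0} :: ('v, 'a) vec set)"
      by (auto simp: monom_ideal_def emb_0)
    then show ?case by (simp add: ideal_reg_upto_def edge_monoms_def reg_upto_zero)
  next
    case (insert x V)
    interpret colon_sequence K "edge_monoms {} V" x
      by standard (rule upset_edge_monoms)
    have "colon = edge_monoms {} V"
      using insert.hyps by (auto simp: edge_monoms_def lookup_add lookup_xdeg split: if_splits)
    then show ?case
    proof (cases n)
      case (Suc m)
      have "ideal_reg_upto K (Suc m) 1 adjoin"
        by (rule adjoin_variable) (simp_all add: \<open>colon = _\<close> insert.IH)
      then show ?thesis unfolding Suc edge_monoms_adjoin by simp
    qed (simp add: ideal_reg_upto_def)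
  qed
qed

lemma matching_number_ge:
  fixes E :: "'v::finite set set"
  assumes "is_matching E M" shows "card M \<le> matching_number E"
  unfolding matching_number_def using assms by (intro Max_ge) auto

lemma maximum_matching:
  fixes E :: "'v::finite set set"
  obtains M where "is_matching E M" "card M = matching_number E"
proof -
  have "is_matching E {}" by (simp add: is_matching_def)
  then have "matching_number E \<in> {card M | M. is_matching E M}"
    unfolding matching_number_def by (intro Max_in) auto
  then show thesis using that by auto
qed

lemma matching_number_mono:
  fixes E :: "'v::finite set set"
  assumes "E \<subseteq> E'" shows "matching_number E \<le> matching_number E'"
proof -
  obtain M where "is_matching E M" "card M = matching_number E" by (rule maximum_matching)
  then show ?thesis using matching_number_ge[of E' M] assms by (auto simp: is_matching_def)
qed

lemma matching_number_insert_edge: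
  fixes E :: "'v::finite set set"
  assumes "E' \<subseteq> E" "e \<in> E" "e \<noteq> {}" "\<And>f. f \<in> E' \<Longrightarrow> f \<inter> e = {}"
  shows "matching_number E' + 1 \<le> matching_number E"
proof -
  obtain M where M: "is_matching E' M" "card M = matching_number E'" by (rule maximum_matching)
  have "e \<notin> M" using M(1) assms(3,4) by (auto simp: is_matching_def)
  have "is_matching E (insert e M)"
    using M(1) assms by (auto simp: is_matching_def pairwise_insert disjnt_def)
  from matching_number_ge[OF this] show ?thesis using \<open>e \<notin> M\<close> M(2) by simp
qed

text \<open>
  An edge meeting \<open>V\<close> is redundant. Otherwise take an end \<open>x\<close> of an edge: adding \<open>x\<close> to the ideal
  removes the edges at \<open>x\<close>, while in the colon ideal by \<open>x\<close> the neighbours of \<open>x\<close> become generators and only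
  edges disjoint from \<open>x\<close> and its neighbours remain to be counted. The latter have a smaller matching
  number, which makes up for the degree shift in \<open>remove_variable\<close>.
\<close>
theorem edge_ideal_reg:
  fixes E :: "'v::finite set set" and K :: "'k::field itself"
  assumes "simple_graph E"
  shows "ideal_reg_upto K n (int (matching_number E) + 1) (edge_monoms E V)"
  using assms
proof (induction "card E" arbitrary: E V rule: less_induct)
  case less
  have smaller: "card F < card E" if "F \<subset> E" for F
    using that by (intro psubset_card_mono) auto
  have simple: "simple_graph F" if "F \<subseteq> E" for F
    using that less.prems by (auto simp: simple_graph_def)
  have IH: "ideal_reg_upto K n (int (matching_number F) + 1) (edge_monoms F Y)" if "F \<subset> E" for F Y
    using less.hyps[OF smaller[OF that] simple] that by blast
  consider "E = {}" | e v where "e \<in> E" "v \<in> e" "v \<in> V" | e where "e \<in> E" "\<forall>e\<in>E. e \<inter> V = {}"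
    by blast
  then show ?case
  proof cases
    case 1
    show ?thesis unfolding 1 by (rule ideal_reg_upto_mono[OF variables_reg]) simp
  next
    case 2
    then have "edge_monoms E V = edge_monoms (E - {e}) V" by (auto simp: edge_monoms_def)
    moreover have "E - {e} \<subset> E" using 2 by blast
    moreover have "matching_number (E - {e}) \<le> matching_number E"
      by (rule matching_number_mono) blast
    ultimately show ?thesis using ideal_reg_upto_mono[OF IH, of "E - {e}"] by simp
  next
    case 3
    have "card e = 2" using 3(1) less.prems by (auto simp: simple_graph_def)
    then obtain x y where e: "e = {x, y}" "x \<noteq> y" by (auto simp: card_2_iff)
    have "e \<inter> V = {}" using 3 by simp
    then have xX: "x \<notin> V" using e by simp
    interpret colon_sequence K "edge_monoms E V" x
      by standard (rule upset_edge_monoms)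
    define N where "N = {y. y \<noteq> x \<and> {x, y} \<in> E}"
    define E1 where "E1 = {e \<in> E. x \<notin> e}"
    define E2 where "E2 = {e \<in> E. e \<inter> insert x N = {}}"
    have "e \<notin> E1" "e \<notin> E2" using e by (simp_all add: E1_def E2_def)
    then have sub: "E1 \<subset> E" "E2 \<subset> E" using 3(1) by (auto simp: E1_def E2_def)
    have edge: "\<exists>y\<in>N. f = {x, y}" if f: "f \<in> E" "x \<in> f" for f
    proof -
      have "card f = 2" using f less.prems by (auto simp: simple_graph_def)
      then obtain y where "f = {x, y}" "x \<noteq> y" using f(2) by (auto simp: card_2_iff)
      then show ?thesis using f(1) by (auto simp: N_def)
    qed
    have colon_iff: "xdeg x + m \<in> edge_monoms E V \<longleftrightarrow>
        (\<exists>v\<in>V. 0 < Poly_Mapping.lookup m v) \<or> (\<exists>f\<in>E. \<forall>v\<in>f - {x}. 0 < Poly_Mapping.lookup m v)" for m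
    proof -
      have pos: "0 < Poly_Mapping.lookup (xdeg x + m) v \<longleftrightarrow> v = x \<or> 0 < Poly_Mapping.lookup m v" for v
        by (simp add: lookup_add lookup_xdeg)
      have "(\<forall>v\<in>f. v = x \<or> R v) \<longleftrightarrow> (\<forall>v\<in>f - {x}. R v)" for R f
        by blast
      moreover have "(\<exists>v\<in>V. v = x \<or> 0 < Poly_Mapping.lookup m v) \<longleftrightarrow> (\<exists>v\<in>V. 0 < Poly_Mapping.lookup m v)"
        using xX by (intro bex_cong) auto
      ultimately show ?thesis unfolding edge_monoms_def mem_Collect_eq pos by simp
    qed
    have "colon = edge_monoms E2 (V \<union> N)"
    proof (intro equalityI subsetI)
      fix m assume "m \<in> colon"
      then consider v where "v \<in> V" "0 < Poly_Mapping.lookup m v"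
        | f where "f \<in> E" "\<forall>v\<in>f - {x}. 0 < Poly_Mapping.lookup m v"
        using colon_iff by auto
      then show "m \<in> edge_monoms E2 (V \<union> N)"
      proof cases
        case (2 f)
        show ?thesis
        proof (cases "x \<in> f")
          case True
          then obtain y where "y \<in> N" "f = {x, y}" using edge 2(1) by blast
          then show ?thesis using 2 by (auto simp: edge_monoms_def N_def)
        next
          case False
          then show ?thesis using 2 by (cases "f \<inter> N = {}") (auto simp: edge_monoms_def E2_def)
        qed
      qed (auto simp: edge_monoms_def)
    next
      fix m assume "m \<in> edge_monoms E2 (V \<union> N)"
      then consider v where "v \<in> V" "0 < Poly_Mapping.lookup m v"
        | v where "v \<in> N" "0 < Poly_Mapping.lookup m v"
        | f where "f \<in> E" "\<forall>v\<in>f. 0 < Poly_Mapping.lookup m v"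
        by (auto simp: edge_monoms_def E2_def)
      then show "m \<in> colon"
      proof cases
        case (2 v)
        then have "{x, v} \<in> E" "\<forall>w\<in>{x, v} - {x}. 0 < Poly_Mapping.lookup m w" by (auto simp: N_def)
        then show ?thesis using colon_iff by blast
      qed (use colon_iff in blast)+
    qed
    moreover have "int (matching_number E2) + 1 \<le> int (matching_number E) + 1 - 1"
      using matching_number_insert_edge[of E2 E e] 3(1) e sub(2) by (force simp: E2_def N_def)
    ultimately have "ideal_reg_upto K n (int (matching_number E) + 1 - 1) colon"
      using ideal_reg_upto_mono[OF IH[OF sub(2)]] by simp
    moreover have "ideal_reg_upto K n (int (matching_number E) + 1) adjoin"
      unfolding edge_monoms_adjoin E1_def[symmetric]
      using ideal_reg_upto_mono[OF IH[OF sub(1)]] matching_number_mono[of E1 E] sub(1) by simp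
    ultimately show ?thesis by (intro remove_variable) simp_all
  qed
qed

section \<open>The quotient by an ideal\<close>

lemma poly_ring_simps:
  "carrier poly_ring = UNIV" "a \<otimes>\<^bsub>poly_ring\<^esub> b = a * b" "a \<oplus>\<^bsub>poly_ring\<^esub> b = a + b"
  "\<one>\<^bsub>poly_ring\<^esub> = 1" "\<zero>\<^bsub>poly_ring\<^esub> = 0"
  by (simp_all add: ring_of_type_algebra_def)

lemma ring_poly_ring: "ring (poly_ring :: ('v, 'k::field) mpoly ring)"
  by (rule ring_from_type_algebra)

lemma uminus_poly_ring: "\<ominus>\<^bsub>poly_ring\<^esub> a = - (a :: ('v, 'k::field) mpoly)"
proof -
  interpret ring "poly_ring :: ('v, 'k) mpoly ring" by (rule ring_poly_ring)
  show ?thesis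
    using minus_equality[of "- a" a] by (simp add: poly_ring_simps)
qed

lemma ideal_monom_ideal:
  assumes "upset B" shows "ideal (monom_ideal B :: ('v, 'k::field) mpoly set) poly_ring"
proof (rule idealI[OF ring_poly_ring])
  interpret ring "poly_ring :: ('v, 'k) mpoly ring" by (rule ring_poly_ring)
  show "subgroup (monom_ideal B :: ('v, 'k) mpoly set) (add_monoid poly_ring)"
  proof (rule add.subgroupI)
    show "(monom_ideal B :: ('v, 'k) mpoly set) \<noteq> {}" using monom_ideal_0 by blast
  qed (auto simp: poly_ring_simps uminus_poly_ring intro: monom_ideal_add monom_ideal_uminus[OF assms])
  show "x \<otimes>\<^bsub>poly_ring\<^esub> a \<in> monom_ideal B" "a \<otimes>\<^bsub>poly_ring\<^esub> x \<in> monom_ideal B"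
    if "a \<in> monom_ideal B" for a x :: "('v, 'k) mpoly"
    using monom_ideal_mult[OF assms that, of x] by (simp_all add: poly_ring_simps mult.commute)
qed

lemma poly_ring_idealD:
  fixes I :: "('v, 'k::field) mpoly set"
  assumes "ideal I poly_ring"
  shows "0 \<in> I" "\<And>a b. a \<in> I \<Longrightarrow> b \<in> I \<Longrightarrow> a + b \<in> I" "\<And>a b. b \<in> I \<Longrightarrow> a * b \<in> I"
  using additive_subgroup.zero_closed[OF ideal.axioms(1)[OF assms]]
    additive_subgroup.a_closed[OF ideal.axioms(1)[OF assms]] ideal.I_l_closed[OF assms]
  by (auto simp: poly_ring_simps)

text \<open>
  A polynomial all of whose monomials are divisible by an edge is the sum of its terms, and each term is a
  multiple of a generator.
\<close>
lemma edge_ideal_eq_monom_ideal: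
  fixes E :: "'v::finite set set"
  assumes "simple_graph E"
  shows "(edge_ideal E :: ('v, 'k::field) mpoly set) = monom_ideal (edge_monoms E {})"
proof
  let ?G = "{pvar a * pvar b | a b. {a, b} \<in> E} :: ('v, 'k) mpoly set"
  interpret ring "poly_ring :: ('v, 'k) mpoly ring" by (rule ring_poly_ring)
  have prod: "pvar a * pvar b = (Poly_Mapping.single (xdeg a + xdeg b) 1 :: ('v, 'k) mpoly)" for a b
    by (simp add: pvar_eq mult_single)
  have "xdeg a + xdeg b \<in> edge_monoms E {}" if "{a, b} \<in> E" for a b
    using that by (auto simp: edge_monoms_def lookup_add lookup_xdeg intro!: bexI[of _ "{a, b}"])
  then have "?G \<subseteq> monom_ideal (edge_monoms E {})"
    by (auto simp: prod monom_ideal_def)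
  then show "(edge_ideal E :: ('v, 'k) mpoly set) \<subseteq> monom_ideal (edge_monoms E {})"
    unfolding edge_ideal_def
    by (intro genideal_minimal ideal_monom_ideal upset_edge_monoms)
  define J where "J = (edge_ideal E :: ('v, 'k) mpoly set)"
  have G: "?G \<subseteq> J"
    unfolding J_def edge_ideal_def by (rule genideal_self) (simp add: poly_ring_simps)
  have "ideal J poly_ring"
    unfolding J_def edge_ideal_def by (rule genideal_ideal) (simp add: poly_ring_simps)
  note J = poly_ring_idealD[OF this]
  have single: "Poly_Mapping.single m c \<in> J" if m: "m \<in> edge_monoms E {}" for m c
  proof -
    obtain e where e: "e \<in> E" "\<And>v. v \<in> e \<Longrightarrow> 0 < Poly_Mapping.lookup m v"
      using m by (auto simp: edge_monoms_def)
    have "card e = 2" using e(1) assms by (auto simp: simple_graph_def)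
    then obtain a b where ab: "e = {a, b}" "a \<noteq> b" by (auto simp: card_2_iff)
    have "m = (xdeg a + xdeg b) + (m - (xdeg a + xdeg b))"
      by (rule monom_split) (use e(2) ab in \<open>auto simp: lookup_add lookup_xdeg Suc_le_eq\<close>)
    then have "Poly_Mapping.single m c = Poly_Mapping.single (m - (xdeg a + xdeg b)) c * (pvar a * pvar b)"
      unfolding prod mult_single by (simp add: add.commute)
    moreover have "pvar a * pvar b \<in> J" using G e(1) ab by blast
    ultimately show ?thesis using J(3) by simp
  qed
  show "monom_ideal (edge_monoms E {}) \<subseteq> (edge_ideal E :: ('v, 'k) mpoly set)"
    unfolding J_def[symmetric]
  proof
    fix p :: "('v, 'k) mpoly" assume p: "p \<in> monom_ideal (edge_monoms E {})"
    have "poly_part A p \<in> J" if "finite A" "A \<subseteq> Poly_Mapping.keys p" for A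
      using that
    proof (induction A)
      case empty
      have "poly_part {} p = 0" by (rule poly_part_eq_0) simp
      then show ?case using J(1) by simp
    next
      case (insert m A)
      have "poly_part (insert m A) p = Poly_Mapping.single m (Poly_Mapping.lookup p m) + poly_part A p"
        using insert.hyps
        by (intro poly_mapping_eqI) (auto simp: lookup_poly_part lookup_add lookup_single when_def)
      moreover have "m \<in> edge_monoms E {}" using insert.prems p by (auto simp: monom_ideal_def)
      ultimately show ?case using insert J(2) single by auto
    qed
    from this[of "Poly_Mapping.keys p"] show "p \<in> J" by (simp add: poly_part_self)
  qed
qed

context
  fixes I :: "('v, 'k::field) mpoly set"
  assumes ideal: "ideal I poly_ring"
begin

abbreviation coset :: "('v, 'k) mpoly \<Rightarrow> ('v, 'k) mpoly set" where
  "coset p \<equiv> I +>\<^bsub>poly_ring\<^esub> p"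

lemmas ideal_closed = poly_ring_idealD[OF ideal]

lemma coset_eq: "coset p = (\<lambda>i. i + p) ` I"
  by (auto simp: a_r_coset_def r_coset_def poly_ring_simps)

lemma coset_eq_iff: "coset p = coset q \<longleftrightarrow> p - q \<in> I"
proof
  assume "coset p = coset q"
  moreover have "p \<in> coset p" unfolding coset_eq using ideal_closed(1) by force
  ultimately show "p - q \<in> I" unfolding coset_eq by auto
next
  assume pq: "p - q \<in> I"
  then have qp: "q - p \<in> I" using ideal_closed(3)[of "p - q" "- 1"] by simp
  have "i + p \<in> coset q" "i + q \<in> coset p" if "i \<in> I" for i
  proof -
    have "i + p = (i + (p - q)) + q" "i + q = (i + (q - p)) + p" by simp_all
    then show "i + p \<in> coset q" "i + q \<in> coset p"
      unfolding coset_eq using ideal_closed(2)[OF that pq] ideal_closed(2)[OF that qp] by blast+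
  qed
  then show "coset p = coset q" unfolding coset_eq by blast
qed

lemma quotient_module_simps:
  "carrier (quotient_module I) = range coset"
  "\<zero>\<^bsub>quotient_module I\<^esub> = I"
  "coset p \<oplus>\<^bsub>quotient_module I\<^esub> coset q = coset (p + q)"
  "p \<odot>\<^bsub>quotient_module I\<^esub> coset q = coset (p * q)"
proof -
  interpret ideal I poly_ring by (rule ideal)
  have hom: "coset \<in> ring_hom poly_ring (poly_ring Quot I)" by (rule rcos_ring_hom)
  show "carrier (quotient_module I) = range coset"
    by (auto simp: quotient_module_def Let_def FactRing_def A_RCOSETS_def' poly_ring_simps)
  show "\<zero>\<^bsub>quotient_module I\<^esub> = I"
    by (simp add: quotient_module_def Let_def FactRing_def)
  show "coset p \<oplus>\<^bsub>quotient_module I\<^esub> coset q = coset (p + q)"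
    using ring_hom_add[OF hom, of p q] by (simp add: quotient_module_def Let_def poly_ring_simps)
  show "p \<odot>\<^bsub>quotient_module I\<^esub> coset q = coset (p * q)"
    using ring_hom_mult[OF hom, of p q] by (simp add: quotient_module_def Let_def poly_ring_simps)
qed

lemma coset_eq_zero: "coset p = \<zero>\<^bsub>quotient_module I\<^esub> \<longleftrightarrow> p \<in> I"
proof -
  have "coset 0 = I" unfolding coset_eq by simp
  then show ?thesis using coset_eq_iff[of p 0] by (simp add: quotient_module_simps)
qed

lemma abelian_monoid_quotient_module: "abelian_monoid (quotient_module I)"
proof -
  have zero: "\<zero>\<^bsub>quotient_module I\<^esub> = coset 0"
    using coset_eq_zero ideal_closed(1) by metis
  show ?thesis
    by (rule abelian_monoidI)
      (auto simp: quotient_module_simps(1,3) zero ac_simps)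
qed

text \<open>
  The quotient module inherits its addition and scalar multiplication from the residue class ring, so the
  augmentation is computed on representatives.
\<close>
lemma aug_map_coset:
  assumes "finite (gens F 0)" "\<And>b. b \<in> gens F 0 \<Longrightarrow> aug F b = coset (p b)"
  shows "aug_map (quotient_module I) F u = coset (\<Sum>b\<in>gens F 0. u b * p b)"
proof -
  interpret M: abelian_monoid "quotient_module I" by (rule abelian_monoid_quotient_module)
  have "finsum (quotient_module I) (\<lambda>b. u b \<odot>\<^bsub>quotient_module I\<^esub> aug F b) A = coset (\<Sum>b\<in>A. u b * p b)"
    if "finite A" "A \<subseteq> gens F 0" for A
    using that
  proof (induction A)
    case empty
    show ?case using coset_eq_zero[of 0] ideal_closed(1) by simp
  next
    case (insert a A)
    have summand: "u b \<odot>\<^bsub>quotient_module I\<^esub> aug F b = coset (u b * p b)" if "b \<in> insert a A" for b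
      using insert.prems that assms(2) by (auto simp: quotient_module_simps)
    have car: "coset q \<in> carrier (quotient_module I)" for q
      by (simp add: quotient_module_simps)
    have "finsum (quotient_module I) (\<lambda>b. u b \<odot>\<^bsub>quotient_module I\<^esub> aug F b) (insert a A)
        = (u a \<odot>\<^bsub>quotient_module I\<^esub> aug F a) \<oplus>\<^bsub>quotient_module I\<^esub>
            finsum (quotient_module I) (\<lambda>b. u b \<odot>\<^bsub>quotient_module I\<^esub> aug F b) A"
      by (rule M.finsum_insert) (use insert.hyps summand car in auto)
    then show ?case
      using insert summand[of a] by (simp add: quotient_module_simps)
  qed
  from this[OF assms(1)] show ?thesis by (simp add: aug_map_def)
qed

end

section \<open>Minimal resolutions\<close>

text \<open>
  A column of the matrix of the differential: the image of a basis vector. The differential is then the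
  combination map of its columns, and exactness says that the syzygies of one family of columns are
  generated by the next one.
\<close>
definition dif_column :: "('v, 'k::field, 'm) free_complex \<Rightarrow> nat \<Rightarrow> nat \<Rightarrow> ('v, 'k) vec" where
  "dif_column F i b = (\<lambda>a. if a \<in> gens F i then dif F i a b else 0)"

lemma free_part_eq: "free_part F i = free (gens F i)"
  by (simp add: free_part_def free_def)

lemma dif_map_eq: "dif_map F i = comb (gens F (Suc i)) (dif_column F i)"
  by (intro ext) (auto simp: dif_map_def comb_apply dif_column_def mult.commute)

lemma comb_image_free: "comb S y ` free S = range (comb S y)"
proof (intro equalityI subsetI)
  fix x assume "x \<in> range (comb S y)"
  then obtain u where "x = comb S y (restr S u)" by (auto simp: comb_restr)
  then show "x \<in> comb S y ` free S" using restr_in_free by blast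
qed blast

locale minimal_resolution =
  fixes M :: "(('v::finite, 'k::field) mpoly, 'm) module" and gr and F
  assumes minimal: "minimal_graded_free_resolution M gr F"
begin

lemma finite_gens: "finite (gens F i)"
  using minimal by (simp add: minimal_graded_free_resolution_def graded_free_resolution_def)

lemma dif_homog:
  "a \<in> gens F i \<Longrightarrow> b \<in> gens F (Suc i) \<Longrightarrow> dif F i a b \<in> homog_component (gdeg F (Suc i) b - gdeg F i a)"
  using minimal by (simp add: minimal_graded_free_resolution_def graded_free_resolution_def)

lemma exact: "syz (gens F (Suc i)) (dif_column F i) = range (dif_map F (Suc i))"
proof -
  have "{u \<in> free_part F (Suc i). dif_map F i u = (\<lambda>_. 0)} = dif_map F (Suc i) ` free_part F (Suc (Suc i))"
    using minimal by (simp add: minimal_graded_free_resolution_def graded_free_resolution_def)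
  then show ?thesis
    by (simp add: free_part_eq dif_map_eq comb_image_free syz_def zero_fun_def)
qed

lemma aug_kernel: "{u \<in> free (gens F 0). aug_map M F u = \<zero>\<^bsub>M\<^esub>} = range (dif_map F 0)"
proof -
  have "{u \<in> free_part F 0. aug_map M F u = \<zero>\<^bsub>M\<^esub>} = dif_map F 0 ` free_part F 1"
    using minimal by (simp add: minimal_graded_free_resolution_def graded_free_resolution_def)
  then show ?thesis
    by (simp add: free_part_eq dif_map_eq comb_image_free)
qed

lemma aug_surj: "aug_map M F ` free (gens F 0) = carrier M"
  using minimal by (simp add: minimal_graded_free_resolution_def graded_free_resolution_def free_part_eq)

lemma aug_homog: "b \<in> gens F 0 \<Longrightarrow> aug F b \<in> gr (gdeg F 0 b)"
  using minimal by (simp add: minimal_graded_free_resolution_def graded_free_resolution_def)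

lemma dif_map_const: "Poly_Mapping.lookup (dif_map F i u a) 0 = 0"
proof -
  have "dif_map F i u \<in> dif_map F i ` free_part F (Suc i)"
    by (simp add: free_part_eq dif_map_eq comb_image_free)
  then show ?thesis using minimal by (auto simp: minimal_graded_free_resolution_def)
qed

lemma dif_gens:
  "homogeneous_gens (gdeg F i) (range (dif_map F i)) (gens F (Suc i)) (gdeg F (Suc i)) (dif_column F i)"
  using dif_homog[unfolded homog_iff_hpart]
  by (auto simp: homogeneous_gens_def finite_gens dif_map_eq dif_column_def vec_hp_simps)

lemma dif_minimal_gens: "minimal_gens (gens F (Suc i)) (dif_column F i)"
  unfolding minimal_gens_def exact using dif_map_const by auto

text \<open>
  By \<open>reg_upto_syz\<close> the bound passes from each image to the next, and by \<open>minimal_gens_degree_le\<close> it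
  controls the generators mapping onto it.
\<close>
lemma degree_bound:
  assumes "\<And>n. reg_upto n r (gdeg F 0) (range (dif_map F 0))"
  shows "b \<in> gens F (Suc i) \<Longrightarrow> gdeg F (Suc i) b \<le> r + int i"
proof -
  have step: "gdeg F (Suc i) b \<le> r + int i"
    if "\<And>n. reg_upto n (r + int i) (gdeg F i) (range (dif_map F i))" "b \<in> gens F (Suc i)" for b i
    using minimal_gens_degree_le[OF dif_gens dif_minimal_gens that(1) that(2)] .
  have "reg_upto n (r + int i) (gdeg F i) (range (dif_map F i))" for n
  proof (induction i arbitrary: n)
    case 0 show ?case using assms by simp
  next
    case (Suc i)
    have "reg_upto n (r + int i + 1) (gdeg F (Suc i)) (syz (gens F (Suc i)) (dif_column F i))"
      by (rule reg_upto_syz[OF dif_gens step[OF Suc] Suc])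
    then show ?case by (simp add: exact algebra_simps)
  qed
  then show "b \<in> gens F (Suc i) \<Longrightarrow> gdeg F (Suc i) b \<le> r + int i" by (rule step)
qed

text \<open>
  By minimality no column of a differential vanishes, because a vanishing column would make a basis vector
  a cycle. The entries are homogeneous without constant term, so a nonzero entry raises the degree by at
  least one.
\<close>
lemma degree_lower_bound:
  assumes "\<And>b. b \<in> gens F 0 \<Longrightarrow> 0 \<le> gdeg F 0 b"
  shows "b \<in> gens F i \<Longrightarrow> int i \<le> gdeg F i b"
proof (induction i arbitrary: b)
  case 0 then show ?case using assms by simp
next
  case (Suc i)
  have "dif_column F i b \<noteq> 0"
  proof
    assume "dif_column F i b = 0"
    then have "unit_vec b \<in> syz (gens F (Suc i)) (dif_column F i)"
      using Suc.prems finite_gens comb_unit_vec[of "gens F (Suc i)" b "dif_column F i"]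
      by (simp add: syz_def free_def unit_vec_def)
    then obtain v where "unit_vec b = dif_map F (Suc i) v" unfolding exact by blast
    then have "Poly_Mapping.lookup (unit_vec b b :: ('v, 'k) mpoly) 0 = 0"
      using dif_map_const[of "Suc i" v b] by metis
    then show False by (simp add: unit_vec_def)
  qed
  then obtain a where a: "dif_column F i b a \<noteq> 0"
    by (auto simp: fun_eq_iff zero_fun_apply)
  then have a': "a \<in> gens F i" "dif F i a b \<noteq> 0"
    by (auto simp: dif_column_def split: if_splits)
  let ?D = "gdeg F (Suc i) b - gdeg F i a"
  have h: "hpart ?D (dif F i a b) = dif F i a b"
    using dif_homog[OF a'(1) Suc.prems] by (simp add: homog_iff_hpart)
  have "dif_column F i b = dif_map F i (unit_vec b)"
    unfolding dif_map_eq by (rule comb_unit_vec[OF finite_gens Suc.prems, symmetric])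
  then have "Poly_Mapping.lookup (dif F i a b) 0 = 0"
    using dif_map_const[of i "unit_vec b" a] a'(1) by (metis dif_column_def)
  then have "hpart 0 (dif F i a b) = 0" by (simp add: hpart_zero_single)
  then have "?D \<noteq> 0" using h a'(2) by metis
  moreover have "\<not> ?D < 0" using h a'(2) hpart_neg by metis
  ultimately show ?case using Suc.IH[OF a'(1)] by simp
qed

end

text \<open>
  Start with one generator of degree 0 mapping to the class of 1, and choose minimal generators of the
  kernel at each stage. The bound on \<open>I\<close> provides finitely many generators at each stage, and passes to
  the next kernel by \<open>reg_upto_syz\<close>.
\<close>
lemma minimal_resolution_exists:
  fixes B :: "('v::finite \<Rightarrow>\<^sub>0 nat) set" and K :: "'k::field itself"
  assumes B: "upset B" "0 \<notin> B" and reg: "\<And>n. ideal_reg_upto K n r B"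
  defines "I \<equiv> (monom_ideal B :: ('v, 'k) mpoly set)"
  shows "\<exists>F. minimal_graded_free_resolution (quotient_module I) (quotient_grading I) F"
proof -
  \<comment> \<open>A stage consists of a finite index set, the degrees of the basis, the generators of the previous
    kernel (a dummy at stage 0), and the present kernel.\<close>
  define P :: "nat \<Rightarrow> nat set \<times> (nat \<Rightarrow> int) \<times> (nat \<Rightarrow> ('v, 'k) vec) \<times> ('v, 'k) vec set \<Rightarrow> bool" where
    "P i = (\<lambda>(S, e, y, U). finite S \<and> U \<subseteq> free S \<and> (\<forall>u\<in>U. \<forall>s. Poly_Mapping.lookup (u s) 0 = 0) \<and>
       (\<forall>n. reg_upto n (r + int i) e U) \<and> (i = 0 \<longrightarrow> S = {0} \<and> e = (\<lambda>_. 0) \<and> U = emb ` I))" for i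
  define Q :: "nat \<Rightarrow> nat set \<times> (nat \<Rightarrow> int) \<times> (nat \<Rightarrow> ('v, 'k) vec) \<times> ('v, 'k) vec set \<Rightarrow>
      nat set \<times> (nat \<Rightarrow> int) \<times> (nat \<Rightarrow> ('v, 'k) vec) \<times> ('v, 'k) vec set \<Rightarrow> bool" where
    "Q i = (\<lambda>(S, e, y, U) (S', e', y', U'). homogeneous_gens e U S' e' y' \<and> U' = syz S' y')" for i
  have const: "Poly_Mapping.lookup p 0 = 0" if "p \<in> I" for p
    using that B(2) by (auto simp: I_def monom_ideal_def in_keys_iff)
  have "\<exists>f. \<forall>n. P n (f n) \<and> Q n (f n) (f (Suc n))"
  proof (rule dependent_nat_choice)
    have "emb ` I \<subseteq> free {0}" "\<forall>u\<in>emb ` I. \<forall>s. Poly_Mapping.lookup (u s) 0 = 0"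
      using const by (auto simp: emb_def free_def)
    then have "P 0 ({0}, (\<lambda>_. 0), (\<lambda>_. 0), emb ` I)"
      using reg by (simp add: P_def ideal_reg_upto_def I_def)
    then show "\<exists>x. P 0 x" by blast
  next
    fix x i assume "P i x"
    obtain S e y U where x: "x = (S, e, y, U)" by (metis prod_cases4)
    have U: "finite S" "U \<subseteq> free S" and regU: "\<And>n. reg_upto n (r + int i) e U"
      using \<open>P i x\<close> by (auto simp: P_def x)
    obtain T f z where T: "homogeneous_gens e U T f z" "\<And>s. s \<in> T \<Longrightarrow> f s \<le> r + int i"
      using regU[of "Suc 0"] by auto
    obtain T' where T': "homogeneous_gens e U T' f z" "minimal_gens T' z" "T' \<subseteq> T"
      using minimal_gens_exist[OF T(1)] by metis
    have "reg_upto n (r + int (Suc i)) f (syz T' z)" for n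
      using reg_upto_syz[OF T'(1) _ regU] T(2) T'(3) by (simp add: subset_iff algebra_simps)
    then have "P (Suc i) (T', f, z, syz T' z)"
      using T' by (auto simp: P_def minimal_gens_def homogeneous_gens_def syz_def)
    moreover have "Q i x (T', f, z, syz T' z)" using T'(1) by (simp add: Q_def x)
    ultimately show "\<exists>y. P (Suc i) y \<and> Q i x y" by blast
  qed
  then obtain f where f: "\<And>n. P n (f n)" "\<And>n. Q n (f n) (f (Suc n))" by blast
  define S where "S i = fst (f i)" for i
  define e where "e i = fst (snd (f i))" for i
  define y where "y i = fst (snd (snd (f i)))" for i
  define U where "U i = snd (snd (snd (f i)))" for i
  have fi: "f i = (S i, e i, y i, U i)" for i by (simp add: S_def e_def y_def U_def)
  have S: "finite (S i)" "U i \<subseteq> free (S i)" "\<And>u s. u \<in> U i \<Longrightarrow> Poly_Mapping.lookup (u s) 0 = 0" for i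
    using f(1)[of i] by (auto simp: P_def fi)
  have S0: "S 0 = {0}" "e 0 = (\<lambda>_. 0)" "U 0 = emb ` I"
    using f(1)[of 0] by (auto simp: P_def fi)
  have next_gens: "homogeneous_gens (e i) (U i) (S (Suc i)) (e (Suc i)) (y (Suc i))" "U (Suc i) = syz (S (Suc i)) (y (Suc i))" for i
    using f(2)[of i] by (auto simp: Q_def fi)
  have id: "ideal I poly_ring" unfolding I_def by (rule ideal_monom_ideal[OF B(1)])
  define F :: "('v, 'k, ('v, 'k) mpoly set) free_complex" where
    "F = \<lparr>gens = S, gdeg = e, dif = (\<lambda>i a b. y (Suc i) b a), aug = (\<lambda>_. I +>\<^bsub>poly_ring\<^esub> 1)\<rparr>"
  have F: "gens F = S" "gdeg F = e" "dif F i a b = y (Suc i) b a" "aug F b = I +>\<^bsub>poly_ring\<^esub> 1" for i a b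
    by (simp_all add: F_def)
  have "y (Suc i) b \<in> free (S i)" if "b \<in> S (Suc i)" for i b
    using homogeneous_gens_mem[OF next_gens(1) that] S(2) by blast
  then have dif: "dif_map F i = comb (S (Suc i)) (y (Suc i))" for i
    unfolding dif_map_eq F by (intro ext comb_cong) (auto simp: dif_column_def F free_def)
  have range: "range (comb (S (Suc i)) (y (Suc i))) = U i" for i
    using next_gens(1)[of i] by (simp add: homogeneous_gens_def)
  have aug: "aug_map (quotient_module I) F u = I +>\<^bsub>poly_ring\<^esub> u 0" for u
    using aug_map_coset[OF id, of F "\<lambda>_. 1" u] by (simp add: F S0)
  have "graded_free_resolution (quotient_module I) (quotient_grading I) F"
    unfolding graded_free_resolution_def free_part_eq dif F
  proof (intro conjI allI ballI)
    show "finite (S i)" for i by (rule S(1))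
    show "y (Suc i) b a \<in> homog_component (e (Suc i) b - e i a)"
      if "a \<in> S i" "b \<in> S (Suc i)" for i a b
    proof -
      have "hp (e i) (e (Suc i) b) (y (Suc i) b) = y (Suc i) b"
        using next_gens(1)[of i] that(2) by (simp add: homogeneous_gens_def)
      then show ?thesis unfolding homog_iff_hpart by (metis hp_apply)
    qed
    show "I +>\<^bsub>poly_ring\<^esub> 1 \<in> quotient_grading I (e 0 b)" if "b \<in> S 0" for b
      by (auto simp: quotient_grading_def S0 homog_iff_hpart hpart_1)
    show "aug_map (quotient_module I) F ` free (S 0) = carrier (quotient_module I)"
    proof -
      have "I +>\<^bsub>poly_ring\<^esub> p \<in> aug_map (quotient_module I) F ` free (S 0)" for p
        by (rule image_eqI[of _ _ "emb p"]) (auto simp: aug S0 free_def emb_def)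
      then show ?thesis by (auto simp: quotient_module_simps[OF id] aug)
    qed
    show "{u \<in> free (S 0). aug_map (quotient_module I) F u = \<zero>\<^bsub>quotient_module I\<^esub>}
        = comb (S (Suc 0)) (y (Suc 0)) ` free (S 1)"
      using S0 S(2)[of 0]
      by (simp add: comb_image_free range aug coset_eq_zero[OF id])
        (auto simp: image_iff emb_def free_def fun_eq_iff)
    show "{u \<in> free (S (Suc i)). comb (S (Suc i)) (y (Suc i)) u = (\<lambda>_. 0)}
        = comb (S (Suc (Suc i))) (y (Suc (Suc i))) ` free (S (Suc (Suc i)))" for i
      using next_gens(2)[of i] by (simp add: comb_image_free range syz_def zero_fun_def)
  qed
  moreover have "Poly_Mapping.lookup (dif_map F i u a) 0 = 0" for i u a
  proof -
    have "dif_map F i u \<in> U i" unfolding dif range[symmetric] by simp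
    then show ?thesis by (rule S(3))
  qed
  ultimately show ?thesis
    by (auto simp: minimal_graded_free_resolution_def)
qed

text \<open>
  As the augmentation is onto and \<open>I\<close> has no constant terms, some generator \<open>b\<close> maps to the class of a
  nonzero constant. A second generator would be, up to the kernel of the augmentation, a multiple of \<open>b\<close>,
  which gives an element of that kernel with a coefficient 1, contrary to minimality.
\<close>
lemma minimal_resolution_cyclic:
  fixes B :: "('v::finite \<Rightarrow>\<^sub>0 nat) set"
  assumes B: "upset B" "0 \<notin> B"
  defines "I \<equiv> (monom_ideal B :: ('v, 'k::field) mpoly set)"
  assumes F: "minimal_graded_free_resolution (quotient_module I) (quotient_grading I) F"
  obtains b where "gens F 0 = {b}" "gdeg F 0 b = 0"
    "range (dif_map F 0) = {u \<in> free {b}. u b \<in> I}"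
proof -
  interpret minimal_resolution "quotient_module I" "quotient_grading I" F
    by standard (rule F)
  have id: "ideal I poly_ring" unfolding I_def by (rule ideal_monom_ideal[OF B(1)])
  have const: "Poly_Mapping.lookup p 0 = 0" if "p \<in> I" for p
    using that B(2) by (auto simp: I_def monom_ideal_def in_keys_iff)
  have "\<exists>p. hpart (gdeg F 0 b) p = p \<and> aug F b = I +>\<^bsub>poly_ring\<^esub> p" if "b \<in> gens F 0" for b
    using aug_homog[OF that] by (auto simp: quotient_grading_def homog_iff_hpart)
  then obtain p where p: "\<And>b. b \<in> gens F 0 \<Longrightarrow> hpart (gdeg F 0 b) (p b) = p b"
      "\<And>b. b \<in> gens F 0 \<Longrightarrow> aug F b = I +>\<^bsub>poly_ring\<^esub> p b"
    by metis
  have aug: "aug_map (quotient_module I) F u = I +>\<^bsub>poly_ring\<^esub> (\<Sum>b\<in>gens F 0. u b * p b)" for u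
    by (rule aug_map_coset[OF id finite_gens p(2)])
  have ker: "range (dif_map F 0) = {u \<in> free (gens F 0). (\<Sum>b\<in>gens F 0. u b * p b) \<in> I}"
    unfolding aug_kernel[symmetric] aug coset_eq_zero[OF id] ..
  have "I +>\<^bsub>poly_ring\<^esub> 1 \<in> aug_map (quotient_module I) F ` free (gens F 0)"
    unfolding aug_surj quotient_module_simps[OF id] by simp
  then obtain u where "I +>\<^bsub>poly_ring\<^esub> 1 = I +>\<^bsub>poly_ring\<^esub> (\<Sum>b\<in>gens F 0. u b * p b)"
    unfolding aug by blast
  then have "1 - (\<Sum>b\<in>gens F 0. u b * p b) \<in> I" by (simp add: coset_eq_iff[OF id])
  from const[OF this] have "(\<Sum>b\<in>gens F 0. Poly_Mapping.lookup (u b) 0 * Poly_Mapping.lookup (p b) 0) = 1"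
    by (simp add: lookup_minus lookup_sum lookup_mult_0)
  then obtain b where b: "b \<in> gens F 0" "Poly_Mapping.lookup (p b) 0 \<noteq> 0"
    by (metis (no_types, lifting) mult_zero_right sum.neutral zero_neq_one)
  have deg: "gdeg F 0 b = 0"
    using p(1)[OF b(1)] b(2) by (auto simp: hpart_def lookup_poly_part when_def dest!: arg_cong[of _ _ "\<lambda>q. Poly_Mapping.lookup q 0"] split: if_splits)
  define c where "c = Poly_Mapping.lookup (p b) 0"
  have pb: "p b = Poly_Mapping.single 0 c"
    using p(1)[OF b(1)] by (simp add: deg hpart_zero_single c_def)
  have inv: "q * Poly_Mapping.single 0 c * Poly_Mapping.single 0 (inverse c) = q" for q :: "('v, 'k) mpoly"
    using b(2) by (simp add: mult.assoc mult_single c_def)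
  have gens: "gens F 0 = {b}"
  proof (rule ccontr)
    assume "gens F 0 \<noteq> {b}"
    then obtain b' where b': "b' \<in> gens F 0" "b' \<noteq> b" using b(1) by blast
    define w where "w = unit_vec b' - scale (p b' * Poly_Mapping.single 0 (inverse c)) (unit_vec b)"
    have "w n * p n = (if n = b' then p b' else 0) - (if n = b then p b' else 0)" for n
      using b'(2) inv[of "p b'"]
      by (auto simp: w_def unit_vec_def scale_apply pb ac_simps)
    then have "(\<Sum>n\<in>gens F 0. w n * p n) = 0"
      using b b' finite_gens by (simp add: sum_subtractf)
    moreover have "w \<in> free (gens F 0)"
      using b b' by (auto simp: w_def free_def unit_vec_def scale_apply)
    ultimately have "w \<in> range (dif_map F 0)"
      using ideal_closed(1)[OF id] by (simp add: ker)
    then have "Poly_Mapping.lookup (w b') 0 = 0" using dif_map_const by auto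
    then show False using b'(2) by (simp add: w_def unit_vec_def scale_apply)
  qed
  have "q * p b \<in> I \<longleftrightarrow> q \<in> I" for q
    using ideal_closed(3)[OF id, of "q * p b" "Poly_Mapping.single 0 (inverse c)"]
      ideal_closed(3)[OF id, of q "p b"] inv[of q]
    by (auto simp: pb mult.commute)
  then have "range (dif_map F 0) = {u \<in> free {b}. u b \<in> I}"
    by (simp add: ker gens)
  then show thesis by (rule that[OF gens deg])
qed

theorem theorem1p5:
  fixes E :: "'v::finite set set"
  assumes "simple_graph E"
  shows "reg_quotient (edge_ideal E :: ('v, 'k::field) mpoly set) \<le> int (matching_number E)"
proof -
  let ?B = "edge_monoms E {}"
  let ?\<nu> = "int (matching_number E)"
  define I where "I = (monom_ideal ?B :: ('v, 'k) mpoly set)"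
  have B: "upset ?B" by (rule upset_edge_monoms)
  have B0: "0 \<notin> ?B"
    using assms by (auto simp: edge_monoms_def simple_graph_def)
  have reg: "ideal_reg_upto TYPE('k) n (?\<nu> + 1) ?B" for n
    by (rule edge_ideal_reg[OF assms])
  define F where "F = (SOME F. minimal_graded_free_resolution (quotient_module I) (quotient_grading I) F)"
  have F: "minimal_graded_free_resolution (quotient_module I) (quotient_grading I) F"
    unfolding F_def I_def by (rule someI_ex[OF minimal_resolution_exists[OF B B0 reg]])
  interpret minimal_resolution "quotient_module I" "quotient_grading I" F
    by standard (rule F)
  obtain b where b: "gens F 0 = {b}" "gdeg F 0 b = 0" "range (dif_map F 0) = {u \<in> free {b}. u b \<in> I}"
    by (rule minimal_resolution_cyclic[OF B B0 F[unfolded I_def], folded I_def])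
  define \<phi> :: "('v, 'k) vec \<Rightarrow> ('v, 'k) vec" where "\<phi> w = (\<lambda>n. if n = b then w 0 else 0)" for w
  have "graded_hom (\<lambda>_. 0) (gdeg F 0) 0 \<phi>"
    using b(2) by (auto simp: graded_hom_def \<phi>_def vec_hp_simps intro!: linmapI)
  moreover have "inj_on \<phi> (emb ` I)"
    by (rule inj_onI) (auto simp: \<phi>_def dest!: fun_cong[where x = b])
  moreover have "\<phi> ` emb ` I = range (dif_map F 0)"
  proof (intro equalityI subsetI)
    fix u assume u: "u \<in> range (dif_map F 0)"
    then have "u = \<phi> (emb (u b))" by (auto simp: b(3) \<phi>_def free_def fun_eq_iff)
    then show "u \<in> \<phi> ` emb ` I" using u b(3) by blast
  qed (auto simp: b(3) \<phi>_def free_def)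
  ultimately have regF: "reg_upto n (?\<nu> + 1) (gdeg F 0) (range (dif_map F 0))" for n
    using reg_upto_image[of n "?\<nu> + 1" "\<lambda>_. 0" "emb ` I" "gdeg F 0" 0 \<phi>] reg[of n]
    by (simp add: ideal_reg_upto_def I_def)
  have upper: "gdeg F i a - int i \<le> ?\<nu>" if "a \<in> gens F i" for a i
  proof (cases i)
    case 0
    then show ?thesis using that b(1,2) by simp
  next
    case (Suc m)
    then show ?thesis using degree_bound[OF regF, of a m] that by simp
  qed
  have lower: "0 \<le> gdeg F i a - int i" if "a \<in> gens F i" for a i
    using degree_lower_bound[of a i] that b(1,2) by simp
  let ?R = "{j - int i | i j. graded_betti (quotient_module I) (quotient_grading I) i j \<noteq> 0}"
  have betti: "graded_betti (quotient_module I) (quotient_grading I) i j \<noteq> 0 \<longleftrightarrow>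
      (\<exists>a\<in>gens F i. gdeg F i a = j)" for i j
    using finite_gens[of i] by (auto simp: graded_betti_def F_def[symmetric] card_eq_0_iff)
  have R: "?R = {gdeg F i a - int i | i a. a \<in> gens F i}"
    unfolding betti by blast
  have sub: "?R \<subseteq> {0..?\<nu>}" unfolding R using lower upper by auto
  have "?R \<noteq> {}" unfolding R using b(1) by blast
  with finite_subset[OF sub] have "Max ?R \<in> ?R" by (intro Max_in) simp_all
  with sub have "Max ?R \<le> ?\<nu>" by (meson atLeastAtMost_iff subsetD)
  then show ?thesis
    unfolding edge_ideal_eq_monom_ideal[OF assms] regularity_def I_def .
qed

end
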